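(* Let $M$ be a connected smooth manifold equipped with a Finsleroid-Finsler metric $F$, determined by a Riemannian metric $a$, a 1-form $b$ of unit length with respect to $a$, and a function $K\colon M\to(-4,4)$ (so that the Finsleroid charge is $K/2$). Then $(M,F)$ is a generalized Berwald space if and only if the Finsleroid charge is constant on $M$ (equivalently, $K$ is a constant function).
   Context: Finsleroid-Finsler metric. Let $M$ be a smooth $n$-dimensional manifold, let $(x^i,y^i)$ be the induced local coordinates on $TM$, let $a=(a_{ij}(x))$ be a Riemannian metric on $M$, let $b=(b_i(x))$ be a smooth 1-form with $a^{ij}b_ib_j=1$, and let $K\colon M\to(-4,4)$ be a smooth function. Put $\alpha=\sqrt{a_{ij}y^iy^j}$ and $\beta=b_iy^i$ (the Finsleroid axis 1-form). The Finsleroid charge is the function $K/2$. The Finsleroid-Finsler metric is the function $F\colon TM\to\mathbb{R}$, $F\ge 0$, whose energy $E=\tfrac12F^2$ is $$E=\frac12\left(\alpha^2+\frac K2\,\beta\sqrt{\alpha^2-\beta^2}\right)\exp\!\left(\frac{2K}{\sqrt{16-K^2}}\arctan\left(\frac{1}{\sqrt{16-K^2}}\Big(\frac{4\beta}{\sqrt{\alpha^2-\beta^2}}+K\Big)\right)\right),$$ extended continuously to the nonzero vectors with $\alpha^2=\beta^2$, i.e. to the nonzero multiples of the $a$-dual vector field $\beta^\sharp$ of $b$ (the exponential factor being $e^{\pm\frac{2K}{\sqrt{16-K^2}}\frac{\pi}{2}}$ in the direction of $\pm\beta^\sharp$), and by $0$ on the zero section. The metric is "$y$-local": it is allowed to fail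 to be smooth in the directions $\pm\beta^\sharp$. Generalized Berwald space. A linear connection $\nabla$ on $M$ (torsion allowed) is compatible with $F$ if the parallel transports with respect to $\nabla$ along curves in $M$ preserve the Finslerian length $F(v)$ of tangent vectors $v$. The space $(M,F)$ is a generalized Berwald space (manifold) if it admits a compatible linear connection. *)

theory Defs
  imports "HOL-Analysis.Analysis"
begin

section \<open>Smooth maps between normed spaces\<close>

primrec Ck_on :: "nat \<Rightarrow> 'a::real_normed_vector set \<Rightarrow> ('a \<Rightarrow> 'b::real_normed_vector) \<Rightarrow> bool" where
  "Ck_on 0 S f \<longleftrightarrow> continuous_on S f"
| "Ck_on (Suc k) S f \<longleftrightarrow>
     (\<forall>x\<in>S. f differentiable (at x)) \<and> (\<forall>v. Ck_on k S (\<lambda>x. frechet_derivative f (at x) v))"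

(* Only meaningful for open S, since derivatives are taken with respect to full neighbourhoods. *)
definition smooth_on :: "'a::real_normed_vector set \<Rightarrow> ('a \<Rightarrow> 'b::real_normed_vector) \<Rightarrow> bool" where
  "smooth_on S f \<longleftrightarrow> (\<forall>k. Ck_on k S f)"

section \<open>Smooth manifolds\<close>

(* A chart is a pair (U, phi); the values of phi outside U are irrelevant. *)
type_synonym ('m, 'n) chart = "'m set \<times> ('m \<Rightarrow> real ^ 'n)"

definition chart_image :: "('m, 'n) chart \<Rightarrow> (real ^ 'n) set" where
  "chart_image c = snd c ` fst c"

definition chart_inv :: "('m, 'n) chart \<Rightarrow> real ^ 'n \<Rightarrow> 'm" where
  "chart_inv c = inv_into (fst c) (snd c)"

definition transition :: "('m, 'n) chart \<Rightarrow> ('m, 'n) chart \<Rightarrow> real ^ 'n \<Rightarrow> real ^ 'n" where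
  "transition c d = snd d \<circ> chart_inv c"

definition smooth_atlas ::
  "('m::{t2_space, second_countable_topology}, 'n::finite) chart set \<Rightarrow> bool" where
  "smooth_atlas A \<longleftrightarrow>
     (\<forall>c\<in>A. open (fst c) \<and> open (chart_image c) \<and>
        homeomorphism (fst c) (chart_image c) (snd c) (chart_inv c)) \<and>
     (\<forall>c\<in>A. \<forall>d\<in>A. smooth_on (snd c ` (fst c \<inter> fst d)) (transition c d))"

(* The underlying manifold M: an open subspace of the ambient (Hausdorff, second countable) type,
   possibly the whole type. *)
definition points :: "('m, 'n) chart set \<Rightarrow> 'm set" where
  "points A = (\<Union>c\<in>A. fst c)"

definition smooth_function :: "('m, 'n::finite) chart set \<Rightarrow> ('m \<Rightarrow> real) \<Rightarrow> bool" where
  "smooth_function A f \<longleftrightarrow> (\<forall>c\<in>A. smooth_on (chart_image c) (f \<circ> chart_inv c))"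

section \<open>Tangent vectors\<close>

(* A tangent vector at p is the family of its component vectors in all charts around p, related
   by the Jacobians of the transition maps (and 0 at the charts not containing p, to make the
   representation unique). Addition and scaling are chartwise. *)
type_synonym ('m, 'n) tvector = "('m, 'n) chart \<Rightarrow> real ^ 'n"

definition tangent_space ::
  "('m, 'n::finite) chart set \<Rightarrow> 'm \<Rightarrow> ('m, 'n) tvector set" where
  "tangent_space A p =
     {v. (\<forall>c. \<not> (c \<in> A \<and> p \<in> fst c) \<longrightarrow> v c = 0) \<and>
         (\<forall>c\<in>A. \<forall>d\<in>A. p \<in> fst c \<inter> fst d \<longrightarrow>
            v d = frechet_derivative (transition c d) (at (snd c p)) (v c))}"

(* The tangent vector at p with components y in the chart c: y^i d/dx^i. *)
definition tvec ::
  "('m, 'n::finite) chart set \<Rightarrow> ('m, 'n) chart \<Rightarrow> 'm \<Rightarrow> real ^ 'n \<Rightarrow> ('m, 'n) tvector" where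
  "tvec A c p y =
     (\<lambda>d. if d \<in> A \<and> p \<in> fst d
          then frechet_derivative (transition c d) (at (snd c p)) y else 0)"

section \<open>Riemannian metrics and 1-forms\<close>

definition metric_comp ::
  "('m, 'n::finite) chart set \<Rightarrow> ('m \<Rightarrow> ('m, 'n) tvector \<Rightarrow> ('m, 'n) tvector \<Rightarrow> real) \<Rightarrow>
   ('m, 'n) chart \<Rightarrow> real ^ 'n \<Rightarrow> real ^ 'n ^ 'n" where
  "metric_comp A a c x =
     (\<chi> i j. a (chart_inv c x) (tvec A c (chart_inv c x) (axis i 1))
                               (tvec A c (chart_inv c x) (axis j 1)))"

definition form_comp ::
  "('m, 'n::finite) chart set \<Rightarrow> ('m \<Rightarrow> ('m, 'n) tvector \<Rightarrow> real) \<Rightarrow>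
   ('m, 'n) chart \<Rightarrow> real ^ 'n \<Rightarrow> real ^ 'n" where
  "form_comp A b c x = (\<chi> i. b (chart_inv c x) (tvec A c (chart_inv c x) (axis i 1)))"

(* y \<mapsto> tvec A c p y identifies R^n with the tangent space at p, so bilinearity is
   expressed through it. *)
definition riemannian_metric ::
  "('m, 'n::finite) chart set \<Rightarrow> ('m \<Rightarrow> ('m, 'n) tvector \<Rightarrow> ('m, 'n) tvector \<Rightarrow> real) \<Rightarrow> bool" where
  "riemannian_metric A a \<longleftrightarrow>
     (\<forall>c\<in>A. \<forall>p\<in>fst c. bilinear (\<lambda>y z. a p (tvec A c p y) (tvec A c p z))) \<and>
     (\<forall>p\<in>points A. \<forall>v\<in>tangent_space A p. \<forall>w\<in>tangent_space A p. a p v w = a p w v) \<and>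
     (\<forall>p\<in>points A. \<forall>v\<in>tangent_space A p. v \<noteq> (\<lambda>_. 0) \<longrightarrow> a p v v > 0) \<and>
     (\<forall>c\<in>A. \<forall>i j. smooth_on (chart_image c) (\<lambda>x. metric_comp A a c x $ i $ j))"

definition one_form ::
  "('m, 'n::finite) chart set \<Rightarrow> ('m \<Rightarrow> ('m, 'n) tvector \<Rightarrow> real) \<Rightarrow> bool" where
  "one_form A b \<longleftrightarrow>
     (\<forall>c\<in>A. \<forall>p\<in>fst c. linear (\<lambda>y. b p (tvec A c p y))) \<and>
     (\<forall>c\<in>A. \<forall>i. smooth_on (chart_image c) (\<lambda>x. form_comp A b c x $ i))"

definition unit_length ::
  "('m, 'n::finite) chart set \<Rightarrow> ('m \<Rightarrow> ('m, 'n) tvector \<Rightarrow> ('m, 'n) tvector \<Rightarrow> real) \<Rightarrow>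
   ('m \<Rightarrow> ('m, 'n) tvector \<Rightarrow> real) \<Rightarrow> bool" where
  "unit_length A a b \<longleftrightarrow>
     (\<forall>c\<in>A. \<forall>x\<in>chart_image c.
        (\<Sum>i\<in>UNIV. \<Sum>j\<in>UNIV. matrix_inv (metric_comp A a c x) $ i $ j *
            form_comp A b c x $ i * form_comp A b c x $ j) = 1)"

section \<open>The Finsleroid-Finsler metric\<close>

(* The second case is the continuous extension to the nonzero multiples of the dual vector
   field of b, where beta is nonzero and alpha^2 = beta^2. *)
definition finsleroid_energy ::
  "('m \<Rightarrow> ('m, 'n) tvector \<Rightarrow> ('m, 'n) tvector \<Rightarrow> real) \<Rightarrow> ('m \<Rightarrow> ('m, 'n) tvector \<Rightarrow> real) \<Rightarrow>
   ('m \<Rightarrow> real) \<Rightarrow> 'm \<Rightarrow> ('m, 'n::finite) tvector \<Rightarrow> real" where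
  "finsleroid_energy a b K p v =
     (let \<alpha> = sqrt (a p v v); \<beta> = b p v; k = K p; s = sqrt (16 - k\<^sup>2) in
      if v = (\<lambda>_. 0) then 0
      else if \<alpha>\<^sup>2 = \<beta>\<^sup>2 then 1/2 * \<alpha>\<^sup>2 * exp (sgn \<beta> * (2 * k / s * (pi / 2)))
      else 1/2 * (\<alpha>\<^sup>2 + k / 2 * \<beta> * sqrt (\<alpha>\<^sup>2 - \<beta>\<^sup>2)) *
           exp (2 * k / s * arctan (1 / s * (4 * \<beta> / sqrt (\<alpha>\<^sup>2 - \<beta>\<^sup>2) + k))))"

definition finsleroid_metric ::
  "('m \<Rightarrow> ('m, 'n) tvector \<Rightarrow> ('m, 'n) tvector \<Rightarrow> real) \<Rightarrow> ('m \<Rightarrow> ('m, 'n) tvector \<Rightarrow> real) \<Rightarrow>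
   ('m \<Rightarrow> real) \<Rightarrow> 'm \<Rightarrow> ('m, 'n::finite) tvector \<Rightarrow> real" where
  "finsleroid_metric a b K p v = sqrt (2 * finsleroid_energy a b K p v)"

definition finsleroid_charge :: "('m \<Rightarrow> real) \<Rightarrow> 'm \<Rightarrow> real" where
  "finsleroid_charge K p = K p / 2"

section \<open>Linear connections and generalized Berwald spaces\<close>

(* A linear connection is given by its Christoffel symbols in each chart,
     G c x u w = (\<Gamma>^k_{ij}(x) u^i w^j)_k,
   where i is the direction of differentiation: nabla_u w = D_u w + G u w. No symmetry is
   required, i.e. torsion is allowed. The last condition is the transformation law under the
   change of coordinates T from c to d. *)
definition linear_connection ::
  "('m, 'n::finite) chart set \<Rightarrow>
   (('m, 'n) chart \<Rightarrow> real ^ 'n \<Rightarrow> real ^ 'n \<Rightarrow> real ^ 'n \<Rightarrow> real ^ 'n) \<Rightarrow> bool" where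
  "linear_connection A G \<longleftrightarrow>
     (\<forall>c\<in>A. \<forall>x\<in>chart_image c. bilinear (G c x)) \<and>
     (\<forall>c\<in>A. \<forall>u w. smooth_on (chart_image c) (\<lambda>x. G c x u w)) \<and>
     (\<forall>c\<in>A. \<forall>d\<in>A. \<forall>x\<in>snd c ` (fst c \<inter> fst d). \<forall>u w.
        (let T = transition c d; DT = (\<lambda>z. frechet_derivative T (at z)) in
         G d (T x) (DT x u) (DT x w) =
           DT x (G c x u w) - frechet_derivative (\<lambda>z. DT z w) (at x) u))"

definition smooth_curve ::
  "('m::topological_space, 'n::finite) chart set \<Rightarrow> real set \<Rightarrow> (real \<Rightarrow> 'm) \<Rightarrow> bool" where
  "smooth_curve A J \<gamma> \<longleftrightarrow>
     open J \<and> is_interval J \<and> \<gamma> ` J \<subseteq> points A \<and> continuous_on J \<gamma> \<and>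
     (\<forall>c\<in>A. smooth_on {t\<in>J. \<gamma> t \<in> fst c} (snd c \<circ> \<gamma>))"

definition parallel_along ::
  "('m, 'n::finite) chart set \<Rightarrow>
   (('m, 'n) chart \<Rightarrow> real ^ 'n \<Rightarrow> real ^ 'n \<Rightarrow> real ^ 'n \<Rightarrow> real ^ 'n) \<Rightarrow>
   real set \<Rightarrow> (real \<Rightarrow> 'm) \<Rightarrow> (real \<Rightarrow> ('m, 'n) tvector) \<Rightarrow> bool" where
  "parallel_along A G J \<gamma> V \<longleftrightarrow>
     (\<forall>t\<in>J. V t \<in> tangent_space A (\<gamma> t)) \<and>
     (\<forall>c\<in>A. \<forall>t\<in>J. \<gamma> t \<in> fst c \<longrightarrow>
        ((\<lambda>r. V r c) has_vector_derivative
           - G c (snd c (\<gamma> t)) (vector_derivative (snd c \<circ> \<gamma>) (at t)) (V t c)) (at t))"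

(* w is the parallel transport along the curve of v, from the parameter s to the parameter t. *)
definition parallel_transport ::
  "('m, 'n::finite) chart set \<Rightarrow>
   (('m, 'n) chart \<Rightarrow> real ^ 'n \<Rightarrow> real ^ 'n \<Rightarrow> real ^ 'n \<Rightarrow> real ^ 'n) \<Rightarrow>
   real set \<Rightarrow> (real \<Rightarrow> 'm) \<Rightarrow> real \<Rightarrow> real \<Rightarrow> ('m, 'n) tvector \<Rightarrow> ('m, 'n) tvector \<Rightarrow> bool" where
  "parallel_transport A G J \<gamma> s t v w \<longleftrightarrow>
     (\<exists>V. parallel_along A G J \<gamma> V \<and> V s = v \<and> V t = w)"

definition compatible_connection ::
  "('m::topological_space, 'n::finite) chart set \<Rightarrow> ('m \<Rightarrow> ('m, 'n) tvector \<Rightarrow> real) \<Rightarrow>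
   (('m, 'n) chart \<Rightarrow> real ^ 'n \<Rightarrow> real ^ 'n \<Rightarrow> real ^ 'n \<Rightarrow> real ^ 'n) \<Rightarrow> bool" where
  "compatible_connection A F G \<longleftrightarrow>
     (\<forall>J \<gamma> s t v w. smooth_curve A J \<gamma> \<longrightarrow> s \<in> J \<longrightarrow> t \<in> J \<longrightarrow>
        parallel_transport A G J \<gamma> s t v w \<longrightarrow> F (\<gamma> t) w = F (\<gamma> s) v)"

definition generalized_berwald ::
  "('m::topological_space, 'n::finite) chart set \<Rightarrow> ('m \<Rightarrow> ('m, 'n) tvector \<Rightarrow> real) \<Rightarrow> bool" where
  "generalized_berwald A F \<longleftrightarrow> (\<exists>G. linear_connection A G \<and> compatible_connection A F G)"

end

theory Submission
  imports Defs "HOL-Real_Asymp.Real_Asymp"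
begin

(* Along the direction of the axis the ratio F(v)/F(-v) attains its maximum over the tangent space at p,
   which is exp(pi |K(p)| / sqrt(16 - K(p)^2)), a strictly increasing function of |K(p)|. Linear
   isometries between tangent spaces preserve this maximum, so parallel transport along short
   segments makes |K| locally constant, and connectedness together with continuity gives that K is
   constant. Conversely, correcting the Levi-Civita connection so that the unit 1-form becomes
   parallel gives a connection that preserves alpha and beta, hence F when K is constant. *)

section \<open>Calculus of smooth maps\<close>

text \<open>The metric may fail to be smooth exactly at the axis, so tangent spaces are not compared
  through derivatives of F there. The ratio F(v)/F(-v) needs only values of F and the fact that
  transport sends -v to the negative of the image of v. Its constant comes from the logarithm of the
  energy: off the axis and for K > 0 the ratio increases with \<beta> / sqrt (\<alpha>^2 -
  \<beta>^2), the logarithms cancel in the limit, and the difference of the two arctangents tends to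
  pi. The ratio cannot see the sign of K, since F is unchanged when K and \<beta> both change sign;
  continuity must exclude a jump between the two remaining values. Compatibility constrains only
  those parallel fields that exist, so solvability of the transport equation has to be established,
  and short segments in one chart suffice. In the converse, the correction term is tensorial, so the
  corrected coefficients obey the transformation law of the Christoffel symbols, which rests on the
  symmetry of second derivatives.\<close>

lemma has_derivative_cong_open:
  assumes "open S" "x \<in> S" "\<And>y. y \<in> S \<Longrightarrow> f y = g y"
  shows "(f has_derivative D) (at x) \<longleftrightarrow> (g has_derivative D) (at x)"
proof
  assume f: "(f has_derivative D) (at x)"
  show "(g has_derivative D) (at x)"
    by (rule has_derivative_transform_within_open[OF f assms(1,2,3)])
next
  assume g: "(g has_derivative D) (at x)"
  show "(f has_derivative D) (at x)"
    by (rule has_derivative_transform_within_open[OF g assms(1,2) assms(3)[symmetric]])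
qed

text \<open>Both sides choose from the same set of derivatives, so the equation survives even at
  points where no derivative exists.\<close>

lemma frechet_derivative_cong_open:
  assumes "open S" "x \<in> S" "\<And>y. y \<in> S \<Longrightarrow> f y = g y"
  shows "frechet_derivative f (at x) = frechet_derivative g (at x)"
  unfolding frechet_derivative_def
  by (rule arg_cong[where f=Eps], rule ext, rule has_derivative_cong_open[OF assms])

lemma differentiable_cong_open:
  assumes "open S" "x \<in> S" "\<And>y. y \<in> S \<Longrightarrow> f y = g y"
  shows "f differentiable (at x) \<longleftrightarrow> g differentiable (at x)"
  unfolding differentiable_def
  by (rule arg_cong[where f=Ex], rule ext, rule has_derivative_cong_open[OF assms])

lemma Ck_on_cong:
  assumes "open S" "\<And>x. x \<in> S \<Longrightarrow> f x = g x"
  shows "Ck_on k S f \<longleftrightarrow> Ck_on k S g"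
  using assms(2)
proof (induction k arbitrary: f g)
  case 0
  then show ?case using continuous_on_cong[OF refl, of S f g] by simp
next
  case (Suc k)
  have "f differentiable (at x) \<longleftrightarrow> g differentiable (at x)" if "x \<in> S" for x
    by (rule differentiable_cong_open[OF assms(1) that Suc.prems])
  moreover have "Ck_on k S (\<lambda>x. frechet_derivative f (at x) v) \<longleftrightarrow>
      Ck_on k S (\<lambda>x. frechet_derivative g (at x) v)" for v
    by (rule Suc.IH) (rule fun_cong[OF frechet_derivative_cong_open[OF assms(1) _ Suc.prems]])
  ultimately show ?case by simp
qed

lemma Ck_on_SucD: "Ck_on (Suc k) S f \<Longrightarrow> Ck_on k S f"
proof (induction k arbitrary: f)
  case 0
  then show ?case
    by (auto intro!: continuous_at_imp_continuous_on differentiable_imp_continuous_within)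
next
  case (Suc k)
  from Suc.prems have d: "\<forall>x\<in>S. f differentiable (at x)"
    and c: "Ck_on (Suc k) S (\<lambda>x. frechet_derivative f (at x) v)" for v
    unfolding Ck_on.simps(2)[of "Suc k"] by simp_all
  show ?case unfolding Ck_on.simps(2)[of k] by (intro conjI allI d Suc.IH c)
qed

text \<open>Replaces the choice hidden in \<open>frechet_derivative\<close> by an explicit formula
  D, valid on S only; all closure rules below go through it.\<close>

lemma Ck_on_SucI:
  assumes "open S" and "\<And>x. x \<in> S \<Longrightarrow> (f has_derivative D x) (at x)"
    and "\<And>v. Ck_on k S (\<lambda>x. D x v)"
  shows "Ck_on (Suc k) S f"
proof -
  have "frechet_derivative f (at x) v = D x v" if "x \<in> S" for x v
    using frechet_derivative_at[OF assms(2)[OF that]] by simp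
  then have "Ck_on k S (\<lambda>x. frechet_derivative f (at x) v) \<longleftrightarrow> Ck_on k S (\<lambda>x. D x v)" for v
    by (intro Ck_on_cong assms(1))
  then show ?thesis using assms by (auto simp: differentiable_def)
qed

lemma Ck_on_has_derivative:
  "Ck_on (Suc k) S f \<Longrightarrow> x \<in> S \<Longrightarrow> (f has_derivative frechet_derivative f (at x)) (at x)"
  by (simp add: frechet_derivative_works)

lemma Ck_on_const: "Ck_on k S (\<lambda>x. c)"
  by (induction k arbitrary: c) (auto simp: frechet_derivative_const)

lemma Ck_on_bounded_linear:
  assumes "open S" "bounded_linear L" "Ck_on k S f"
  shows "Ck_on k S (\<lambda>x. L (f x))"
  using assms(3)
proof (induction k arbitrary: f)
  case 0
  then show ?case using assms(2) by (simp add: bounded_linear.continuous_on)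
next
  case (Suc k)
  show ?case
  proof (rule Ck_on_SucI[OF assms(1), where D="\<lambda>x v. L (frechet_derivative f (at x) v)"])
    show "((\<lambda>x. L (f x)) has_derivative (\<lambda>v. L (frechet_derivative f (at x) v))) (at x)"
      if "x \<in> S" for x
      using bounded_linear.has_derivative[OF assms(2) Ck_on_has_derivative[OF Suc.prems that]] .
  qed (use Suc in auto)
qed

lemma Ck_on_add:
  assumes "open S" "Ck_on k S f" "Ck_on k S g"
  shows "Ck_on k S (\<lambda>x. f x + g x)"
  using assms(2,3)
proof (induction k arbitrary: f g)
  case 0
  then show ?case by (simp add: continuous_on_add)
next
  case (Suc k)
  show ?case
    by (rule Ck_on_SucI[OF assms(1)
          has_derivative_add[OF Ck_on_has_derivative[OF Suc.prems(1)] Ck_on_has_derivative[OF Suc.prems(2)]]])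
      (use Suc in auto)
qed

text \<open>By the product rule the derivative is a sum of two values of P, so the induction must
  vary f and g. Real multiplication, the inner product and the matrix-vector product are
  instances.\<close>

lemma Ck_on_bilinear:
  assumes "open S" "bounded_bilinear P" "Ck_on k S f" "Ck_on k S g"
  shows "Ck_on k S (\<lambda>x. P (f x) (g x))"
  using assms(3,4)
proof (induction k arbitrary: f g)
  case 0
  then show ?case using bounded_bilinear.continuous_on[OF assms(2)] by simp
next
  case (Suc k)
  show ?case
  proof (rule Ck_on_SucI[OF assms(1)
          bounded_bilinear.FDERIV[OF assms(2) Ck_on_has_derivative[OF Suc.prems(1)] Ck_on_has_derivative[OF Suc.prems(2)]]])
    show "Ck_on k S (\<lambda>x. P (f x) (frechet_derivative g (at x) v) + P (frechet_derivative f (at x) v) (g x))" for v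
      using Suc.prems Suc.prems[THEN Ck_on_SucD] by (intro Ck_on_add Suc.IH assms(1)) auto
  qed
qed

text \<open>The derivative of 1/f is a product of 1/f twice and f', so the induction hypothesis for
  the same f closes the argument.\<close>

lemma Ck_on_inverse:
  fixes f :: "'a::real_normed_vector \<Rightarrow> real"
  assumes "open S" "Ck_on k S f" "\<And>x. x \<in> S \<Longrightarrow> f x \<noteq> 0"
  shows "Ck_on k S (\<lambda>x. inverse (f x))"
  using assms(2)
proof (induction k)
  case 0
  then show ?case using assms(3) by (simp add: continuous_on_inverse)
next
  case (Suc k)
  have i: "Ck_on k S (\<lambda>x. inverse (f x))"
    using Suc Ck_on_SucD by blast
  have d: "Ck_on k S (\<lambda>x. frechet_derivative f (at x) v)" for v
    using Suc.prems by simp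
  show ?case
  proof (rule Ck_on_SucI[OF assms(1) Deriv.has_derivative_inverse[OF assms(3) Ck_on_has_derivative[OF Suc.prems]]])
    show "Ck_on k S (\<lambda>x. - (inverse (f x) * frechet_derivative f (at x) v * inverse (f x)))" for v
      by (intro Ck_on_bilinear[OF assms(1) bounded_bilinear_mult]
          Ck_on_bounded_linear[OF assms(1) bounded_linear_minus[OF bounded_linear_ident]] i d)
  qed auto
qed

section \<open>Closure properties of smooth maps\<close>

lemma smooth_on_cong:
  "open S \<Longrightarrow> (\<And>x. x \<in> S \<Longrightarrow> f x = g x) \<Longrightarrow> smooth_on S f \<longleftrightarrow> smooth_on S g"
  unfolding smooth_on_def using Ck_on_cong by blast

lemma smooth_on_differentiable: "smooth_on S f \<Longrightarrow> x \<in> S \<Longrightarrow> f differentiable (at x)"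
  unfolding smooth_on_def by (drule spec[of _ "Suc 0"]) simp

lemma smooth_on_has_derivative:
  "smooth_on S f \<Longrightarrow> x \<in> S \<Longrightarrow> (f has_derivative frechet_derivative f (at x)) (at x)"
  using smooth_on_differentiable frechet_derivative_works by blast

lemma smooth_on_continuous_on: "smooth_on S f \<Longrightarrow> continuous_on S f"
  unfolding smooth_on_def by (drule spec[of _ 0]) simp

lemma smooth_on_derivative:
  "smooth_on S f \<Longrightarrow> smooth_on S (\<lambda>x. frechet_derivative f (at x) v)"
  unfolding smooth_on_def
proof
  fix k assume "\<forall>k. Ck_on k S f"
  then have "Ck_on (Suc k) S f" ..
  then show "Ck_on k S (\<lambda>x. frechet_derivative f (at x) v)" by simp
qed

lemma smooth_on_const: "smooth_on S (\<lambda>x. c)"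
  by (simp add: smooth_on_def Ck_on_const)

lemma smooth_on_bounded_linear:
  "open S \<Longrightarrow> bounded_linear L \<Longrightarrow> smooth_on S f \<Longrightarrow> smooth_on S (\<lambda>x. L (f x))"
  by (simp add: smooth_on_def Ck_on_bounded_linear)

lemma smooth_on_add:
  "open S \<Longrightarrow> smooth_on S f \<Longrightarrow> smooth_on S g \<Longrightarrow> smooth_on S (\<lambda>x. f x + g x)"
  by (simp add: smooth_on_def Ck_on_add)

lemma smooth_on_minus:
  "open S \<Longrightarrow> smooth_on S f \<Longrightarrow> smooth_on S (\<lambda>x. - f x)"
  by (rule smooth_on_bounded_linear[OF _ bounded_linear_minus[OF bounded_linear_ident]])

lemma smooth_on_diff:
  "open S \<Longrightarrow> smooth_on S f \<Longrightarrow> smooth_on S g \<Longrightarrow> smooth_on S (\<lambda>x. f x - g x)"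
  using smooth_on_add[of S f "\<lambda>x. - g x"] smooth_on_minus[of S g] by simp

lemma smooth_on_bilinear:
  "open S \<Longrightarrow> bounded_bilinear P \<Longrightarrow> smooth_on S f \<Longrightarrow> smooth_on S g \<Longrightarrow>
    smooth_on S (\<lambda>x. P (f x) (g x))"
  by (simp add: smooth_on_def Ck_on_bilinear)

lemma smooth_on_sum:
  "open S \<Longrightarrow> (\<And>i. i \<in> I \<Longrightarrow> smooth_on S (f i)) \<Longrightarrow> smooth_on S (\<lambda>x. \<Sum>i\<in>I. f i x)"
  by (induction I rule: infinite_finite_induct) (auto intro: smooth_on_add smooth_on_const)

lemma smooth_on_mult:
  fixes f g :: "'a::real_normed_vector \<Rightarrow> real"
  shows "open S \<Longrightarrow> smooth_on S f \<Longrightarrow> smooth_on S g \<Longrightarrow> smooth_on S (\<lambda>x. f x * g x)"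
  by (rule smooth_on_bilinear[OF _ bounded_bilinear_mult])

lemma smooth_on_prod:
  fixes f :: "'i \<Rightarrow> 'a::real_normed_vector \<Rightarrow> real"
  shows "open S \<Longrightarrow> (\<And>i. i \<in> I \<Longrightarrow> smooth_on S (f i)) \<Longrightarrow> smooth_on S (\<lambda>x. \<Prod>i\<in>I. f i x)"
  by (induction I rule: infinite_finite_induct) (auto intro: smooth_on_mult smooth_on_const)

lemma smooth_on_divide:
  fixes f g :: "'a::real_normed_vector \<Rightarrow> real"
  shows "open S \<Longrightarrow> smooth_on S f \<Longrightarrow> smooth_on S g \<Longrightarrow> (\<And>x. x \<in> S \<Longrightarrow> g x \<noteq> 0) \<Longrightarrow>
    smooth_on S (\<lambda>x. f x / g x)"
  using smooth_on_mult[of S f "\<lambda>x. inverse (g x)"] Ck_on_inverse[of S _ g]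
  by (simp add: divide_inverse smooth_on_def)

lemma smooth_on_nth:
  fixes f :: "'a::real_normed_vector \<Rightarrow> ('b::real_normed_vector) ^ 'n::finite"
  shows "open S \<Longrightarrow> smooth_on S f \<Longrightarrow> smooth_on S (\<lambda>x. f x $ i)"
  by (rule smooth_on_bounded_linear[OF _ bounded_linear_vec_nth])

lemma smooth_on_det:
  fixes m :: "'a::real_normed_vector \<Rightarrow> real ^ 'n ^ 'n::finite"
  assumes "open S" "\<And>i j. smooth_on S (\<lambda>x. m x $ i $ j)"
  shows "smooth_on S (\<lambda>x. det (m x))"
  unfolding det_def
  by (intro smooth_on_sum smooth_on_mult smooth_on_prod smooth_on_const assms)

lemma bounded_linear_axis:
  "bounded_linear (axis i :: 'b::real_normed_vector \<Rightarrow> 'b ^ 'n::finite)"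
proof (rule bounded_linear_intro[where K=1])
  show "norm (axis i x :: 'b ^ 'n) \<le> norm x * 1" for x :: 'b
    by (simp add: norm_vec_def L2_set_def axis_def if_distrib if_distribR cong: if_cong)
qed (auto simp: vec_eq_iff axis_def)

lemma smooth_on_vec:
  fixes f :: "'a::real_normed_vector \<Rightarrow> ('b::real_normed_vector) ^ 'n::finite"
  assumes "open S" "\<And>i. smooth_on S (\<lambda>x. f x $ i)"
  shows "smooth_on S f"
proof -
  have "smooth_on S (\<lambda>x. \<Sum>i\<in>UNIV. axis i (f x $ i))"
    by (intro smooth_on_sum smooth_on_bounded_linear[OF _ bounded_linear_axis] assms)
  moreover have "(\<Sum>i\<in>UNIV. axis i (f x $ i)) = f x" for x
    by (simp add: vec_eq_iff axis_def if_distrib if_distribR cong: if_cong)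
  ultimately show ?thesis by simp
qed

text \<open>The derivative along the line is a directional derivative of f read along the same line,
  so the induction closes without a chain rule of higher order.\<close>

lemma smooth_on_affine_line:
  fixes f :: "'a::real_normed_vector \<Rightarrow> 'b::real_normed_vector"
  assumes S: "open S" and f: "smooth_on S f"
  shows "smooth_on {t. x + t *\<^sub>R h \<in> S} (\<lambda>t. f (x + t *\<^sub>R h))"
proof -
  have o: "open {t. x + t *\<^sub>R h \<in> S}"
  proof -
    have "open ((\<lambda>t. x + t *\<^sub>R h) -` S)"
      by (rule open_vimage[OF S]) (intro continuous_intros)
    then show ?thesis by (simp add: vimage_def)
  qed
  have "Ck_on k {t. x + t *\<^sub>R h \<in> S} (\<lambda>t. f (x + t *\<^sub>R h))" if "Ck_on k S f" for k
    using that
  proof (induction k arbitrary: f)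
    case 0
    then show ?case
      by (auto intro!: continuous_on_compose2[of S f] continuous_intros)
  next
    case (Suc k)
    show ?case
    proof (rule Ck_on_SucI[OF o, where D="\<lambda>t v. v *\<^sub>R frechet_derivative f (at (x + t *\<^sub>R h)) h"])
      fix t assume "t \<in> {t. x + t *\<^sub>R h \<in> S}"
      then have d: "(f has_derivative frechet_derivative f (at (x + t *\<^sub>R h))) (at (x + t *\<^sub>R h))"
        using Suc.prems Ck_on_has_derivative by blast
      have "((\<lambda>t. x + t *\<^sub>R h) has_derivative (\<lambda>v. v *\<^sub>R h)) (at t)"
        by (auto intro!: derivative_eq_intros)
      from has_derivative_compose[OF this d]
      show "((\<lambda>t. f (x + t *\<^sub>R h)) has_derivative
          (\<lambda>v. v *\<^sub>R frechet_derivative f (at (x + t *\<^sub>R h)) h)) (at t)"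
        by (simp add: linear_cmul[OF has_derivative_linear[OF d]])
    next
      show "Ck_on k {t. x + t *\<^sub>R h \<in> S} (\<lambda>t. v *\<^sub>R frechet_derivative f (at (x + t *\<^sub>R h)) h)" for v
        using Suc by (intro Ck_on_bounded_linear[OF o bounded_linear_scaleR_right] Suc.IH) auto
    qed
  qed
  then show ?thesis using f by (simp add: smooth_on_def)
qed

section \<open>Symmetry of second derivatives\<close>

text \<open>Two applications of the mean value theorem: in the direction u to the increment of f
  along h v, then in the direction v to the derivative of f along u.\<close>

lemma second_difference_mean_value:
  fixes f :: "'a::real_normed_vector \<Rightarrow> real"
  assumes S: "open S" and f: "smooth_on S f" and h: "0 < h"
    and sub: "\<And>s t. 0 \<le> s \<Longrightarrow> s \<le> h \<Longrightarrow> 0 \<le> t \<Longrightarrow> t \<le> h \<Longrightarrow> x + s *\<^sub>R u + t *\<^sub>R v \<in> S"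
  obtains s t where "0 < s" "s < h" "0 < t" "t < h"
    and "f (x + h *\<^sub>R u + h *\<^sub>R v) - f (x + h *\<^sub>R u) - f (x + h *\<^sub>R v) + f x
      = h * h * frechet_derivative (\<lambda>y. frechet_derivative f (at y) u) (at (x + s *\<^sub>R u + t *\<^sub>R v)) v"
proof -
  define D where "D = (\<lambda>y. frechet_derivative f (at y) u)"
  have D: "smooth_on S D" unfolding D_def by (rule smooth_on_derivative[OF f])
  have line: "((\<lambda>s. g (y + s *\<^sub>R w)) has_real_derivative frechet_derivative g (at (y + s *\<^sub>R w)) w) (at s)"
    if "smooth_on S g" "y + s *\<^sub>R w \<in> S" for g :: "'a \<Rightarrow> real" and y w s
  proof -
    note d = smooth_on_has_derivative[OF that]
    have "((\<lambda>s. y + s *\<^sub>R w) has_derivative (\<lambda>r. r *\<^sub>R w)) (at s)"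
      by (auto intro!: derivative_eq_intros)
    from has_derivative_compose[OF this d] show ?thesis
      by (simp add: has_field_derivative_def linear_cmul[OF has_derivative_linear[OF d]] mult_commute_abs)
  qed
  define \<phi> where "\<phi> = (\<lambda>s. f (x + h *\<^sub>R v + s *\<^sub>R u) - f (x + s *\<^sub>R u))"
  have "\<exists>s>0. s < h \<and> \<phi> h - \<phi> 0 = (h - 0) * (D (x + h *\<^sub>R v + s *\<^sub>R u) - D (x + s *\<^sub>R u))"
  proof (rule MVT2[OF h])
    fix s assume "0 \<le> s" "s \<le> h"
    then have "x + h *\<^sub>R v + s *\<^sub>R u \<in> S" "x + s *\<^sub>R u \<in> S"
      using sub[of s h] sub[of s 0] h by (simp_all add: algebra_simps)
    then show "(\<phi> has_real_derivative D (x + h *\<^sub>R v + s *\<^sub>R u) - D (x + s *\<^sub>R u)) (at s)"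
      unfolding \<phi>_def D_def by (intro DERIV_diff line f)
  qed
  then obtain s where s: "0 < s" "s < h" and
    1: "\<phi> h - \<phi> 0 = h * (D (x + h *\<^sub>R v + s *\<^sub>R u) - D (x + s *\<^sub>R u))" by auto
  have "\<exists>t>0. t < h \<and> D (x + s *\<^sub>R u + h *\<^sub>R v) - D (x + s *\<^sub>R u + 0 *\<^sub>R v) =
      (h - 0) * frechet_derivative D (at (x + s *\<^sub>R u + t *\<^sub>R v)) v"
  proof (rule MVT2[OF h])
    fix t assume "0 \<le> t" "t \<le> h"
    then have "x + s *\<^sub>R u + t *\<^sub>R v \<in> S" using sub[of s t] s by simp
    then show "((\<lambda>t. D (x + s *\<^sub>R u + t *\<^sub>R v)) has_real_derivative
        frechet_derivative D (at (x + s *\<^sub>R u + t *\<^sub>R v)) v) (at t)"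
      by (intro line D)
  qed
  then obtain t where t: "0 < t" "t < h" and
    2: "D (x + s *\<^sub>R u + h *\<^sub>R v) - D (x + s *\<^sub>R u) =
      h * frechet_derivative D (at (x + s *\<^sub>R u + t *\<^sub>R v)) v" by auto
  have "f (x + h *\<^sub>R u + h *\<^sub>R v) - f (x + h *\<^sub>R u) - f (x + h *\<^sub>R v) + f x = \<phi> h - \<phi> 0"
    by (simp add: \<phi>_def algebra_simps)
  also have "\<dots> = h * (D (x + s *\<^sub>R u + h *\<^sub>R v) - D (x + s *\<^sub>R u))"
    unfolding 1 by (simp add: algebra_simps)
  also have "\<dots> = h * h * frechet_derivative D (at (x + s *\<^sub>R u + t *\<^sub>R v)) v"
    unfolding 2 by simp
  finally show ?thesis using that s t unfolding D_def by blast
qed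

text \<open>The second difference is symmetric in u and v, yet it equals h^2 times either mixed
  derivative at some point near x. Continuity of both mixed derivatives at x forbids them to differ
  there.\<close>

lemma second_derivative_symmetric:
  fixes f :: "'a::real_normed_vector \<Rightarrow> real"
  assumes S: "open S" and f: "smooth_on S f" and x: "x \<in> S"
  shows "frechet_derivative (\<lambda>y. frechet_derivative f (at y) u) (at x) v =
    frechet_derivative (\<lambda>y. frechet_derivative f (at y) v) (at x) u"
proof (rule ccontr)
  define P where "P = (\<lambda>u v y. frechet_derivative (\<lambda>y. frechet_derivative f (at y) u) (at y) v)"
  assume "\<not> ?thesis"
  \<comment> \<open>Half the gap: if both mixed derivatives stay this close to their values at x,
    they cannot take a common value nearby.\<close>
  then have e: "\<bar>P u v x - P v u x\<bar> / 2 > 0" (is "?e > 0") by (simp add: P_def)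
  have "isCont (P u v) x" "isCont (P v u) x"
    using smooth_on_continuous_on[OF smooth_on_derivative[OF smooth_on_derivative[OF f]]] S x
    by (auto simp: P_def continuous_on_eq_continuous_at)
  then have c: "(P u v \<longlongrightarrow> P u v x) (nhds x)" "(P v u \<longlongrightarrow> P v u x) (nhds x)"
    by (simp_all add: isCont_def tendsto_at_iff_tendsto_nhds)
  have "\<forall>\<^sub>F y in nhds x. dist (P u v y) (P u v x) < ?e" "\<forall>\<^sub>F y in nhds x. dist (P v u y) (P v u x) < ?e"
    by (rule tendstoD[OF c(1) e]) (rule tendstoD[OF c(2) e])
  moreover have "\<forall>\<^sub>F y in nhds x. y \<in> S" using S x by (rule eventually_nhds_in_open)
  ultimately have "\<forall>\<^sub>F y in nhds x. y \<in> S \<and> dist (P u v y) (P u v x) < ?e \<and> dist (P v u y) (P v u x) < ?e"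
    by (intro eventually_conj)
  then obtain r where r: "r > 0"
    and R: "\<And>y. dist y x < r \<Longrightarrow> y \<in> S \<and> dist (P u v y) (P u v x) < ?e \<and> dist (P v u y) (P v u x) < ?e"
    by (auto simp: eventually_nhds_metric)
  \<comment> \<open>Keeps the parallelogram with sides h u and h v within distance r of x; the
    summand 1 keeps the denominator positive when u = v = 0.\<close>
  define h where "h = r / (2 * (norm u + norm v + 1))"
  have h: "h > 0" using r by (simp add: h_def add_nonneg_pos)
  have near: "dist (x + s *\<^sub>R u' + t *\<^sub>R v') x < r"
    if "0 \<le> s" "s \<le> h" "0 \<le> t" "t \<le> h" "norm u' + norm v' = norm u + norm v" for s t u' v'
  proof -
    have "dist (x + s *\<^sub>R u' + t *\<^sub>R v') x \<le> s * norm u' + t * norm v'"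
      using that norm_triangle_ineq[of "s *\<^sub>R u'" "t *\<^sub>R v'"] by (simp add: dist_norm)
    also have "\<dots> \<le> h * norm u' + h * norm v'"
      using that by (intro add_mono mult_right_mono) auto
    also have "\<dots> = h * (norm u + norm v)"
      by (metis distrib_left that(5))
    also have "\<dots> < h * (2 * (norm u + norm v + 1))"
      using h by (intro mult_strict_left_mono) (auto intro: add_nonneg_pos add_pos_nonneg simp: add_nonneg_pos algebra_simps add.commute)
    also have "\<dots> = r"
    proof -
      have "norm u + norm v + 1 > 0" by (simp add: add_nonneg_pos)
      then show ?thesis by (simp add: h_def)
    qed
    finally show ?thesis .
  qed
  obtain s t where st: "0 < s" "s < h" "0 < t" "t < h"
    and 1: "f (x + h *\<^sub>R u + h *\<^sub>R v) - f (x + h *\<^sub>R u) - f (x + h *\<^sub>R v) + f x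
      = h * h * P u v (x + s *\<^sub>R u + t *\<^sub>R v)"
    using second_difference_mean_value[OF S f h, of x u v] near[of _ _ u v] R unfolding P_def by metis
  obtain s' t' where st': "0 < s'" "s' < h" "0 < t'" "t' < h"
    and 2: "f (x + h *\<^sub>R v + h *\<^sub>R u) - f (x + h *\<^sub>R v) - f (x + h *\<^sub>R u) + f x
      = h * h * P v u (x + s' *\<^sub>R v + t' *\<^sub>R u)"
    using second_difference_mean_value[OF S f h, of x v u] near[of _ _ v u] R unfolding P_def
    by (metis add.commute)
  have "h * h * P u v (x + s *\<^sub>R u + t *\<^sub>R v) = h * h * P v u (x + s' *\<^sub>R v + t' *\<^sub>R u)"
    unfolding 1[symmetric] 2[symmetric] by (simp add: algebra_simps)
  then have eq: "P u v (x + s *\<^sub>R u + t *\<^sub>R v) = P v u (x + s' *\<^sub>R v + t' *\<^sub>R u)"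
    using h by simp
  have "dist (P u v (x + s *\<^sub>R u + t *\<^sub>R v)) (P u v x) < ?e"
    using R near[of s t u v] st by simp
  moreover have "dist (P v u (x + s' *\<^sub>R v + t' *\<^sub>R u)) (P v u x) < ?e"
    using R near[of s' t' v u] st' by simp
  ultimately have "dist (P u v x) (P v u x) < \<bar>P u v x - P v u x\<bar>"
    unfolding eq by (rule dist_triangle_half_r)
  then show False by (simp add: dist_real_def)
qed

section \<open>Linear ordinary differential equations\<close>

text \<open>Picard iteration on one short interval: the bound on m makes the integral operator a
  contraction, so Banach's fixed point theorem applies directly and no local solutions have to be
  glued. The initial time c may lie anywhere in the interval.\<close>

lemma linear_ode_solution:
  fixes M :: "real \<Rightarrow> 'a::euclidean_space \<Rightarrow> 'a"
  assumes c: "c \<in> {a..b}"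
    and cont: "\<And>v. continuous_on {a..b} (\<lambda>t. M t v)"
    and lin: "\<And>t. t \<in> {a..b} \<Longrightarrow> linear (M t)"
    and bd: "\<And>t v. t \<in> {a..b} \<Longrightarrow> norm (M t v) \<le> m * norm v"
    and m: "0 \<le> m" "2 * (m * (b - a)) < 1"
  obtains V where "V c = v"
    and "\<And>t. t \<in> {a<..<b} \<Longrightarrow> (V has_vector_derivative M t (V t)) (at t)"
proof -
  have ab: "a \<le> b" using c by simp
  \<comment> \<open>Continuity in t is known for each fixed vector only; expanding
    \<open>W t\<close> in the basis covers a moving one.\<close>
  have cM: "continuous_on {a..b} (\<lambda>t. M t (W t))" if W: "continuous_on {a..b} W" for W
  proof -
    have "continuous_on {a..b} (\<lambda>t. \<Sum>i\<in>Basis. (W t \<bullet> i) *\<^sub>R M t i)"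
      by (intro continuous_intros W cont)
    moreover have "(\<Sum>i\<in>Basis. (W t \<bullet> i) *\<^sub>R M t i) = M t (W t)" if "t \<in> {a..b}" for t
    proof -
      interpret linear "M t" by (rule lin[OF that])
      have "M t (\<Sum>i\<in>Basis. (W t \<bullet> i) *\<^sub>R i) = (\<Sum>i\<in>Basis. (W t \<bullet> i) *\<^sub>R M t i)"
        by (simp add: sum scale)
      then show ?thesis by (simp add: euclidean_representation)
    qed
    ultimately show ?thesis by (rule continuous_on_eq)
  qed
  \<comment> \<open>Integrating from a and subtracting the value at c avoids reversed limits of
    integration; these two terms are the source of the factor 2 in the smallness condition.\<close>
  define J where "J W t = integral {a..t} (\<lambda>s. M s (W s))" for W t
  have cJ: "continuous_on {a..b} (J W)" if "continuous_on {a..b} W" for W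
    unfolding J_def using that
    by (intro indefinite_integral_continuous_1 integrable_continuous_real cM)
  define \<Phi> where "\<Phi> W t = v + (J W t - J W c)" for W t
  \<comment> \<open>The contraction acts on the complete space of bounded continuous functions on
    the whole line, so each image is continued constantly outside the interval by
    \<open>clamp\<close>.\<close>
  have "\<exists>g :: real \<Rightarrow>\<^sub>C 'a. (\<forall>x\<in>{a..b}. g x = \<Phi> W x) \<and> (\<forall>x. g x = \<Phi> W (clamp a b x))"
    for W :: "real \<Rightarrow>\<^sub>C 'a"
  proof -
    have "continuous_on (cbox a b) (\<Phi> (apply_bcontfun W))"
      unfolding \<Phi>_def box_real by (intro continuous_intros cJ continuous_on_apply_bcontfun)
    then show ?thesis
      by (metis box_real(2) continuous_on_cbox_bcontfunE)
  qed
  then obtain P :: "(real \<Rightarrow>\<^sub>C 'a) \<Rightarrow> (real \<Rightarrow>\<^sub>C 'a)" where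
    P1: "\<And>W x. x \<in> {a..b} \<Longrightarrow> P W x = \<Phi> W x" and P2: "\<And>W x. P W x = \<Phi> W (clamp a b x)"
    by metis
  have "\<exists>!W. P W = W"
  proof (rule banach_fix_type)
    show "0 \<le> 2 * (m * (b - a))" "2 * (m * (b - a)) < 1" using m ab by auto
    show "\<forall>W Z. dist (P W) (P Z) \<le> 2 * (m * (b - a)) * dist W Z"
    proof (intro allI dist_bound)
      fix W Z :: "real \<Rightarrow>\<^sub>C 'a" and x
      define y where "y = clamp a b x"
      have y: "y \<in> {a..b}" using clamp_in_interval[of a b x] ab by (simp add: y_def)
      have *: "norm (J W t - J Z t) \<le> m * (b - a) * dist W Z" if t: "t \<in> {a..b}" for t
      proof -
        have s: "{a..t} \<subseteq> {a..b}" using t by auto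
        have c: "continuous_on {a..t} (\<lambda>s. M s (apply_bcontfun X s))" for X :: "real \<Rightarrow>\<^sub>C 'a"
          by (rule continuous_on_subset[OF cM s]) (rule continuous_on_apply_bcontfun)
        have "J W t - J Z t = integral {a..t} (\<lambda>s. M s (W s) - M s (Z s))"
          unfolding J_def by (rule Henstock_Kurzweil_Integration.integral_diff[symmetric]; intro integrable_continuous_real c)
        also have "norm \<dots> \<le> (m * dist W Z) * (t - a)"
        proof (rule integral_bound)
          fix s assume "s \<in> {a..t}"
          then have sb: "s \<in> {a..b}" using s by auto
          have "M s (W s) - M s (Z s) = M s (W s - Z s)" by (simp add: linear_diff[OF lin[OF sb]])
          also have "norm \<dots> \<le> m * norm (W s - Z s)" by (rule bd[OF sb])
          also have "\<dots> \<le> m * dist W Z"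
            using m(1) dist_bounded[of W s Z] by (intro mult_left_mono) (auto simp: dist_norm)
          finally show "norm (M s (W s) - M s (Z s)) \<le> m * dist W Z" .
        qed (use t c in \<open>auto intro!: continuous_intros\<close>)
        also have "\<dots> \<le> (m * dist W Z) * (b - a)"
          using t m(1) by (intro mult_left_mono) auto
        finally show ?thesis by (simp add: mult_ac)
      qed
      have "dist (P W x) (P Z x) = norm ((J W y - J Z y) - (J W c - J Z c))"
        by (simp add: P2 \<Phi>_def y_def[symmetric] dist_norm algebra_simps)
      also have "\<dots> \<le> m * (b - a) * dist W Z + m * (b - a) * dist W Z"
        by (intro norm_triangle_le_diff add_mono * y c)
      finally show "dist (P W x) (P Z x) \<le> 2 * (m * (b - a)) * dist W Z" by simp
    qed
  qed
  then obtain W where W: "P W = W" by blast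
  have W': "W x = \<Phi> W x" if "x \<in> {a..b}" for x using P1[OF that, of W] W by simp
  show ?thesis
  proof (rule that[of "apply_bcontfun W"])
    show "W c = v" using W'[OF c] by (simp add: \<Phi>_def)
    fix t assume t: "t \<in> {a<..<b}"
    then have "(J W has_vector_derivative M t (W t)) (at t within {a..b})"
      unfolding J_def using c by (intro integral_has_vector_derivative cM) auto
    then have "(J W has_vector_derivative M t (W t)) (at t)"
      using t by (simp add: at_within_Icc_at)
    then have "(\<Phi> W has_vector_derivative M t (W t)) (at t)"
      unfolding \<Phi>_def by (auto intro!: derivative_eq_intros)
    then show "(apply_bcontfun W has_vector_derivative M t (W t)) (at t)"
      by (rule has_vector_derivative_transform_within_open[of _ _ _ "{a<..<b}"])
        (use t W' in auto)
  qed
qed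

section \<open>The indicatrix along the Finsleroid axis\<close>

lemma charge_discriminant_pos:
  fixes k :: real
  assumes "\<bar>k\<bar> < 4"
  shows "0 < 16 - k\<^sup>2"
  using assms abs_square_less_1[of "k / 4"] by (simp add: power_divide)

lemma finsleroid_quadratic_pos:
  fixes k t :: real
  assumes k: "\<bar>k\<bar> < 4"
  shows "0 < t\<^sup>2 + 1 + k / 2 * t"
proof -
  have e: "16 * (t\<^sup>2 + 1 + k / 2 * t) = (4 * t + k)\<^sup>2 + (16 - k\<^sup>2)"
    by (simp add: power2_eq_square algebra_simps)
  have "16 * (t\<^sup>2 + 1 + k / 2 * t) > 0"
    unfolding e using charge_discriminant_pos[OF k] by (intro add_nonneg_pos) auto
  then show ?thesis by (simp add: zero_less_mult_iff)
qed

text \<open>The logarithm of 2E on the slice \<alpha>^2 - \<beta>^2 = 1, as a function of t =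
  \<beta>. Off the axis, homogeneity reduces E to this slice.\<close>

definition log_profile :: "real \<Rightarrow> real \<Rightarrow> real" where
  "log_profile k t = ln (t\<^sup>2 + 1 + k / 2 * t) +
     2 * k / sqrt (16 - k\<^sup>2) * arctan (1 / sqrt (16 - k\<^sup>2) * (4 * t + k))"

text \<open>The arctangent is odd and each product of k with t or with the arctangent keeps its
  value. This symmetry is why reversal detects only the absolute value of the charge.\<close>

lemma log_profile_minus: "log_profile (- k) (- t) = log_profile k t"
proof -
  have e: "- (4 * t) + - k = - (4 * t + k)" by simp
  have "arctan (1 / sqrt (16 - (- k)\<^sup>2) * (4 * (- t) + - k)) =
      - arctan (1 / sqrt (16 - k\<^sup>2) * (4 * t + k))"
    by (simp only: e mult_minus_right power2_minus arctan_minus)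
  then show ?thesis unfolding log_profile_def by (simp only: mult_minus_left mult_minus_right
        minus_minus minus_mult_minus minus_divide_left[symmetric] power2_minus)
qed

text \<open>Completing the square gives 16 Q = (4 t + k)^2 + (16 - k^2) for the quadratic Q in the
  logarithm, so the arctangent term also has derivative with denominator Q. It contributes k/2,
  which turns the numerator 2 t + k/2 of the logarithm into 2 t + k.\<close>

lemma log_profile_derivative:
  assumes k: "\<bar>k\<bar> < 4"
  shows "(log_profile k has_real_derivative (2 * t + k) / (t\<^sup>2 + 1 + k / 2 * t)) (at t)"
proof -
  define s where "s = sqrt (16 - k\<^sup>2)"
  define Q where "Q = t\<^sup>2 + 1 + k / 2 * t"
  have s: "s > 0" "s\<^sup>2 = 16 - k\<^sup>2" using charge_discriminant_pos[OF k] by (simp_all add: s_def)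
  have Q: "Q > 0" using finsleroid_quadratic_pos[OF k] by (simp add: Q_def)
  have "(1 + (1 / s * (4 * t + k))\<^sup>2) * s\<^sup>2 = s\<^sup>2 + (4 * t + k)\<^sup>2"
    using s(1) by (simp add: power_mult_distrib power_divide distrib_right)
  also have "\<dots> = 16 * Q"
    unfolding Q_def s(2) by (simp add: power2_eq_square algebra_simps)
  finally have a: "1 + (1 / s * (4 * t + k))\<^sup>2 = 16 * Q / s\<^sup>2"
    using s(1) by (simp add: eq_divide_eq)
  have "((\<lambda>t. t\<^sup>2 + 1 + k / 2 * t) has_real_derivative 2 * t + k / 2) (at t)"
    by (auto intro!: derivative_eq_intros)
  from DERIV_chain2[OF DERIV_ln_divide[OF Q[unfolded Q_def]] this]
  have d1: "((\<lambda>t. ln (t\<^sup>2 + 1 + k / 2 * t)) has_real_derivative 1 / Q * (2 * t + k / 2)) (at t)"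
    by (simp only: Q_def)
  have "((\<lambda>t. 1 / s * (4 * t + k)) has_real_derivative 1 / s * 4) (at t)"
    by (intro DERIV_cmult) (auto intro!: derivative_eq_intros)
  from DERIV_cmult[OF DERIV_chain2[OF DERIV_arctan this], of "2 * k / s"]
  have d2: "((\<lambda>t. 2 * k / s * arctan (1 / s * (4 * t + k))) has_real_derivative
      2 * k / s * (inverse (16 * Q / s\<^sup>2) * (1 / s * 4))) (at t)"
    by (simp only: a)
  have "1 / Q * (2 * t + k / 2) + 2 * k / s * (inverse (16 * Q / s\<^sup>2) * (1 / s * 4)) =
      (2 * t + k / 2) / Q + k / 2 / Q"
    using s(1) Q by (simp add: power2_eq_square)
  also have "\<dots> = (2 * t + k) / Q" unfolding add_divide_distrib[symmetric] by simp
  finally show ?thesis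
    using DERIV_add[OF d1 d2] unfolding log_profile_def s_def[symmetric] Q_def[symmetric] by simp
qed

text \<open>The difference has derivative 2 k / (Q(t) Q(-t)), which is nonnegative, so every value
  is bounded by the limit at infinity, that is, by the value approached in the direction of the
  axis.\<close>

lemma log_profile_diff_le_nonneg:
  assumes k: "0 \<le> k" "k < 4"
  shows "log_profile k t - log_profile k (- t) \<le> 2 * pi * k / sqrt (16 - k\<^sup>2)"
proof (rule tendsto_lowerbound)
  define s where "s = sqrt (16 - k\<^sup>2)"
  have k': "\<bar>k\<bar> < 4" using k by simp
  have s: "s > 0" using charge_discriminant_pos[OF k'] by (simp add: s_def)
  define R where "R = (\<lambda>t. log_profile k t - log_profile k (- t))"
  have dR: "(R has_real_derivative 2 * k / ((t\<^sup>2 + 1 + k / 2 * t) * (t\<^sup>2 + 1 - k / 2 * t))) (at t)" for t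
  proof -
    have p: "t\<^sup>2 + 1 + k / 2 * t > 0" "t\<^sup>2 + 1 - k / 2 * t > 0"
      using finsleroid_quadratic_pos[OF k', of t] finsleroid_quadratic_pos[OF k', of "- t"] by auto
    have "((\<lambda>t. log_profile k (- t)) has_real_derivative
        (2 * (- t) + k) / ((- t)\<^sup>2 + 1 + k / 2 * (- t)) * (- 1)) (at t)"
      by (rule DERIV_chain2[where g = uminus, OF log_profile_derivative[OF k']])
        (auto intro!: derivative_eq_intros)
    from DERIV_diff[OF log_profile_derivative[OF k'] this]
    have "(R has_real_derivative (2 * t + k) / (t\<^sup>2 + 1 + k / 2 * t) -
        (2 * (- t) + k) / ((- t)\<^sup>2 + 1 + k / 2 * (- t)) * (- 1)) (at t)" unfolding R_def .
    moreover have "(2 * t + k) / (t\<^sup>2 + 1 + k / 2 * t) -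
        (2 * (- t) + k) / ((- t)\<^sup>2 + 1 + k / 2 * (- t)) * (- 1) =
        2 * k / ((t\<^sup>2 + 1 + k / 2 * t) * (t\<^sup>2 + 1 - k / 2 * t))"
    proof -
      define A B where "A = t\<^sup>2 + 1 + k / 2 * t" and "B = t\<^sup>2 + 1 - k / 2 * t"
      have "(2 * t + k) / A + (k - 2 * t) / B = ((2 * t + k) * B + (k - 2 * t) * A) / (A * B)"
        using p by (simp add: A_def B_def add_frac_eq)
      also have "(2 * t + k) * B + (k - 2 * t) * A = 2 * t * (B - A) + k * (A + B)"
        by (simp add: algebra_simps)
      also have "B - A = - (k * t)" by (simp add: A_def B_def)
      also have "A + B = 2 * t\<^sup>2 + 2" by (simp add: A_def B_def)
      also have "2 * t * - (k * t) + k * (2 * t\<^sup>2 + 2) = 2 * k"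
        by (simp add: power2_eq_square algebra_simps)
      finally show ?thesis by (simp add: A_def B_def)
    qed
    ultimately show ?thesis by simp
  qed
  show "\<forall>\<^sub>F x in at_top. log_profile k t - log_profile k (- t) \<le> R x"
  proof (rule eventually_mono[OF eventually_ge_at_top[of t]])
    fix x assume "t \<le> x"
    then have "R t \<le> R x"
    proof (rule DERIV_nonneg_imp_nondecreasing)
      fix y
      have "2 * k / ((y\<^sup>2 + 1 + k / 2 * y) * (y\<^sup>2 + 1 - k / 2 * y)) \<ge> 0"
        using finsleroid_quadratic_pos[OF k', of y] finsleroid_quadratic_pos[OF k', of "- y"] k
        by (intro divide_nonneg_nonneg mult_nonneg_nonneg) auto
      then show "\<exists>d. (R has_real_derivative d) (at y) \<and> 0 \<le> d" using dR by blast
    qed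
    then show "log_profile k t - log_profile k (- t) \<le> R x" by (simp add: R_def)
  qed
  \<comment> \<open>The quadratics agree to leading order, so the logarithms cancel; only the two
    arctangents, with limits pi/2 and -pi/2, survive and give 2 k / s times pi.\<close>
  have l: "((\<lambda>t. ln (t\<^sup>2 + 1 + k / 2 * t) - ln (t\<^sup>2 + 1 - k / 2 * t)) \<longlongrightarrow> 0) at_top"
    by real_asymp
  have a1: "((\<lambda>t. arctan (1 / s * (4 * t + k))) \<longlongrightarrow> pi / 2) at_top"
    using s by real_asymp
  have a2: "((\<lambda>t. arctan (1 / s * (4 * (- t) + k))) \<longlongrightarrow> - (pi / 2)) at_top"
    using s by real_asymp
  have "((\<lambda>t. (ln (t\<^sup>2 + 1 + k / 2 * t) - ln (t\<^sup>2 + 1 - k / 2 * t)) +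
      2 * k / s * (arctan (1 / s * (4 * t + k)) - arctan (1 / s * (4 * (- t) + k))))
      \<longlongrightarrow> 0 + 2 * k / s * (pi / 2 - - (pi / 2))) at_top"
    by (intro tendsto_intros l a1 a2)
  moreover have "(\<lambda>t. (ln (t\<^sup>2 + 1 + k / 2 * t) - ln (t\<^sup>2 + 1 - k / 2 * t)) +
      2 * k / s * (arctan (1 / s * (4 * t + k)) - arctan (1 / s * (4 * (- t) + k)))) = R"
    by (simp add: R_def log_profile_def s_def[symmetric] fun_eq_iff right_diff_distrib)
  ultimately show "(R \<longlongrightarrow> 2 * pi * k / sqrt (16 - k\<^sup>2)) at_top"
    by (simp add: s_def mult_ac)
qed simp

text \<open>For negative k the symmetry of the profile moves the claim to -k and -t.\<close>

lemma log_profile_diff_le: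
  assumes "\<bar>k\<bar> < 4"
  shows "log_profile k t - log_profile k (- t) \<le> 2 * pi * \<bar>k\<bar> / sqrt (16 - k\<^sup>2)"
proof (cases "0 \<le> k")
  case True
  then show ?thesis using log_profile_diff_le_nonneg[of k t] assms by simp
next
  case False
  then show ?thesis
    using log_profile_diff_le_nonneg[of "- k" "- t"] log_profile_minus[of k t]
      log_profile_minus[of k "- t"] assms by simp
qed

text \<open>The energy of a nonzero vector sees the vector only through A = \<alpha>^2 and B =
  \<beta>; this form separates the real analysis from the manifold.\<close>

definition energy_profile :: "real \<Rightarrow> real \<Rightarrow> real \<Rightarrow> real" where
  "energy_profile k A B =
     (if A = B\<^sup>2 then 1/2 * A * exp (sgn B * (2 * k / sqrt (16 - k\<^sup>2) * (pi / 2)))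
      else 1/2 * (A + k / 2 * B * sqrt (A - B\<^sup>2)) *
        exp (2 * k / sqrt (16 - k\<^sup>2) * arctan (1 / sqrt (16 - k\<^sup>2) * (4 * B / sqrt (A - B\<^sup>2) + k))))"

text \<open>Factoring out A - B^2 leaves the positive quadratic in B / sqrt (A - B^2), which can
  then be absorbed into the exponent as a logarithm.\<close>

lemma energy_profile_eq_exp:
  assumes k: "\<bar>k\<bar> < 4" and AB: "B\<^sup>2 < A"
  shows "energy_profile k A B = 1/2 * (A - B\<^sup>2) * exp (log_profile k (B / sqrt (A - B\<^sup>2)))"
proof -
  define q where "q = sqrt (A - B\<^sup>2)"
  have q: "q > 0" "q\<^sup>2 = A - B\<^sup>2" using AB by (simp_all add: q_def)
  have p: "(B / q)\<^sup>2 + 1 + k / 2 * (B / q) > 0" by (rule finsleroid_quadratic_pos[OF k])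
  have "A + k / 2 * B * q = (A - B\<^sup>2) * ((B / q)\<^sup>2 + 1 + k / 2 * (B / q))"
    unfolding q(2)[symmetric] using q AB by (simp add: power_divide field_simps power2_eq_square)
  then show ?thesis
    using AB p by (simp add: energy_profile_def log_profile_def q_def[symmetric] exp_add)
qed

lemma energy_profile_pos:
  assumes "\<bar>k\<bar> < 4" "B\<^sup>2 \<le> A" "0 < A"
  shows "0 < energy_profile k A B"
proof (cases "A = B\<^sup>2")
  case False
  then show ?thesis using assms by (simp add: energy_profile_eq_exp)
qed (use assms in \<open>simp add: energy_profile_def\<close>)

lemma energy_profile_reversal_le:
  assumes k: "\<bar>k\<bar> < 4" and AB: "B\<^sup>2 \<le> A" and A: "0 < A"
  shows "energy_profile k A B \<le> energy_profile k A (- B) * exp (2 * pi * \<bar>k\<bar> / sqrt (16 - k\<^sup>2))"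
proof (cases "A = B\<^sup>2")
  case True
  \<comment> \<open>On the axis the two exponents are opposite numbers of size pi |k| / sqrt (16 -
    k^2), so they differ by at most twice that.\<close>
  have "sgn B * (2 * k / sqrt (16 - k\<^sup>2) * (pi / 2)) \<le>
      - (sgn B * (2 * k / sqrt (16 - k\<^sup>2) * (pi / 2))) + 2 * pi * \<bar>k\<bar> / sqrt (16 - k\<^sup>2)"
    using charge_discriminant_pos[OF k] by (auto simp: sgn_if field_simps abs_if)
  then show ?thesis
    using True A by (simp add: energy_profile_def sgn_minus mult.assoc exp_add[symmetric])
next
  case False
  then have less: "B\<^sup>2 < A" using AB by simp
  have "log_profile k (B / sqrt (A - B\<^sup>2)) \<le>
      log_profile k (- B / sqrt (A - B\<^sup>2)) + 2 * pi * \<bar>k\<bar> / sqrt (16 - k\<^sup>2)"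
    using log_profile_diff_le[OF k, of "B / sqrt (A - B\<^sup>2)"] by simp
  then have "exp (log_profile k (B / sqrt (A - B\<^sup>2))) \<le>
      exp (log_profile k (- B / sqrt (A - B\<^sup>2))) * exp (2 * pi * \<bar>k\<bar> / sqrt (16 - k\<^sup>2))"
    by (simp add: exp_add[symmetric])
  then have "1/2 * (A - B\<^sup>2) * exp (log_profile k (B / sqrt (A - B\<^sup>2))) \<le> 1/2 * (A - B\<^sup>2) *
      (exp (log_profile k (- B / sqrt (A - B\<^sup>2))) * exp (2 * pi * \<bar>k\<bar> / sqrt (16 - k\<^sup>2)))"
    using less by (intro mult_left_mono) auto
  then show ?thesis
    using less
    by (simp only: energy_profile_eq_exp[OF k] power2_minus mult.assoc)
qed

text \<open>The unit axis vectors realise the reversal bound. Both orientations are recorded because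
  the sign of k decides which one is extremal.\<close>

lemma energy_profile_axis:
  "energy_profile k 1 1 = energy_profile k 1 (- 1) * exp (2 * pi * k / sqrt (16 - k\<^sup>2))"
  "energy_profile k 1 (- 1) = energy_profile k 1 1 * exp (2 * pi * (- k) / sqrt (16 - k\<^sup>2))"
  by (simp_all add: energy_profile_def exp_add[symmetric] field_simps)

text \<open>If y < x, passing from y to x enlarges the numerator and shrinks the positive
  denominator, so the ratio is strictly increasing.\<close>

lemma charge_ratio_le_imp_le:
  assumes "0 \<le> x" "x < 4" "0 \<le> y" "y < 4" "x / sqrt (16 - x\<^sup>2) \<le> y / sqrt (16 - y\<^sup>2)"
  shows "x \<le> y"
proof (rule ccontr)
  assume "\<not> x \<le> y"
  then have yx: "y < x" by simp
  then have "y\<^sup>2 < x\<^sup>2" "x\<^sup>2 < 16"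
    using assms power_strict_mono[of y x 2] power_strict_mono[of x 4 2] by auto
  then have "0 < sqrt (16 - x\<^sup>2)" "sqrt (16 - x\<^sup>2) < sqrt (16 - y\<^sup>2)" by auto
  then have "y / sqrt (16 - y\<^sup>2) < x / sqrt (16 - x\<^sup>2)"
    using yx assms by (intro frac_less) auto
  then show False using assms by simp
qed

section \<open>The metric connection with parallel unit form, in coordinates\<close>

lemma bounded_bilinear_matrix_vector_mult:
  "bounded_bilinear ((*v) :: real ^ 'n::finite ^ 'm::finite \<Rightarrow> real ^ 'n \<Rightarrow> real ^ 'm)"
  unfolding bilinear_conv_bounded_bilinear[symmetric] bilinear_def
  by (auto intro!: linearI simp: matrix_vector_mult_add_rdistrib matrix_vector_right_distrib
      scaleR_matrix_vector_assoc matrix_vector_mult_scaleR)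

lemma matrix_inv_right:
  fixes m :: "real ^ 'n ^ 'n"
  shows "invertible m \<Longrightarrow> m ** matrix_inv m = mat 1"
  unfolding matrix_inv_def invertible_def by (rule someI2_ex) auto

text \<open>The musical isomorphism: for invertible m it is the vector whose image under m has the
  coefficients of the covector \<omega>.\<close>

definition sharp :: "real ^ 'n ^ 'n \<Rightarrow> (real ^ 'n \<Rightarrow> real) \<Rightarrow> real ^ 'n::finite" where
  "sharp m \<omega> = matrix_inv m *v (\<chi> i. \<omega> (axis i 1))"

lemma matrix_mult_sharp:
  "invertible m \<Longrightarrow> m *v sharp m \<omega> = (\<chi> i. \<omega> (axis i 1))"
  by (simp add: sharp_def matrix_vector_mul_assoc matrix_inv_right)

lemma linear_eq_inner:
  fixes \<omega> :: "real ^ 'n::finite \<Rightarrow> real"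
  assumes "linear \<omega>"
  shows "\<omega> z = (\<chi> i. \<omega> (axis i 1)) \<bullet> z"
proof -
  interpret linear \<omega> by fact
  have "z = (\<Sum>i\<in>UNIV. z $ i *\<^sub>R axis i 1)"
    using basis_expansion[of z] by (simp add: scalar_mult_eq_scaleR)
  then have "\<omega> z = (\<Sum>i\<in>UNIV. z $ i * \<omega> (axis i 1))"
    by (metis (mono_tags, lifting) scale sum sum.cong real_scaleR_def)
  then show ?thesis by (simp add: inner_vec_def mult.commute)
qed

lemma linear_sharp:
  assumes "\<And>z. linear (\<lambda>u. f u z)"
  shows "linear (\<lambda>u. sharp m (f u))"
proof -
  have "linear (\<lambda>u. \<chi> i. f u (axis i 1))"
    using assms unfolding linear_iff by (simp add: vec_eq_iff)
  then show ?thesis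
    unfolding sharp_def using linear_compose[OF _ matrix_vector_mul_linear] by (auto simp: o_def)
qed

text \<open>Cramer's rule writes each component as a quotient of determinants, which are polynomials
  in smooth entries; the smoothness of the inverse matrix itself never has to be discussed.\<close>

lemma smooth_on_sharp:
  fixes m :: "'a::real_normed_vector \<Rightarrow> real ^ 'n ^ 'n::finite"
  assumes S: "open S" and m: "\<And>i j. smooth_on S (\<lambda>x. m x $ i $ j)"
    and inv: "\<And>x. x \<in> S \<Longrightarrow> invertible (m x)"
    and w: "\<And>i. smooth_on S (\<lambda>x. \<omega> x (axis i 1))"
  shows "smooth_on S (\<lambda>x. sharp (m x) (\<omega> x))"
proof (rule smooth_on_vec[OF S])
  fix k
  have d: "det (m x) \<noteq> 0" if "x \<in> S" for x
    using inv[OF that] by (simp add: invertible_det_nz)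
  have e: "sharp (m x) (\<omega> x) $ k =
      det (\<chi> i j. if j = k then \<omega> x (axis i 1) else m x $ i $ j) / det (m x)" if "x \<in> S" for x
    using cramer[OF d[OF that], of "sharp (m x) (\<omega> x)" "\<chi> i. \<omega> x (axis i 1)"] inv[OF that]
    by (simp add: matrix_mult_sharp cong: if_cong)
  have "smooth_on S (\<lambda>x. (\<chi> i j. if j = k then \<omega> x (axis i 1) else m x $ i $ j) $ i $ j)" for i j
    using m w by (cases "j = k") simp_all
  then have "smooth_on S (\<lambda>x. det (\<chi> i j. if j = k then \<omega> x (axis i 1) else m x $ i $ j) / det (m x))"
    by (intro smooth_on_divide smooth_on_det m d S)
  then show "smooth_on S (\<lambda>x. sharp (m x) (\<omega> x) $ k)"
    using smooth_on_cong[OF S e] by simp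
qed

text \<open>The derivative in the direction u of g(w, z) for constant coordinate fields w and
  z.\<close>

definition metric_deriv ::
  "(real ^ 'n \<Rightarrow> real ^ 'n ^ 'n) \<Rightarrow> real ^ 'n \<Rightarrow> real ^ 'n \<Rightarrow> real ^ 'n \<Rightarrow> real ^ 'n::finite \<Rightarrow> real" where
  "metric_deriv g x u w z = w \<bullet> (frechet_derivative g (at x) u *v z)"

text \<open>Christoffel symbols of the first kind: the Koszul formula for constant coordinate
  fields, whose brackets vanish.\<close>

definition koszul ::
  "(real ^ 'n \<Rightarrow> real ^ 'n ^ 'n) \<Rightarrow> real ^ 'n \<Rightarrow> real ^ 'n \<Rightarrow> real ^ 'n \<Rightarrow> real ^ 'n::finite \<Rightarrow> real" where
  "koszul g x u w z =
     (metric_deriv g x u w z + metric_deriv g x w u z - metric_deriv g x z u w) / 2"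

definition levi_civita ::
  "(real ^ 'n \<Rightarrow> real ^ 'n ^ 'n) \<Rightarrow> real ^ 'n \<Rightarrow> real ^ 'n \<Rightarrow> real ^ 'n \<Rightarrow> real ^ 'n::finite" where
  "levi_civita g x u w = sharp (g x) (koszul g x u w)"

text \<open>The covariant derivative (D_u b)(w) for the Levi-Civita connection D.\<close>

definition covariant_form ::
  "(real ^ 'n \<Rightarrow> real ^ 'n ^ 'n) \<Rightarrow> (real ^ 'n \<Rightarrow> real ^ 'n) \<Rightarrow>
   real ^ 'n \<Rightarrow> real ^ 'n \<Rightarrow> real ^ 'n::finite \<Rightarrow> real" where
  "covariant_form g \<beta> x u w = frechet_derivative \<beta> (at x) u \<bullet> w - \<beta> x \<bullet> levi_civita g x u w"

(* With D the Levi-Civita connection, nabla_u w = D_u w + (D_u b)(w) b# - b(w) D_u b#; the correction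
   is skew for the metric, and it kills the derivative of b because b has unit length. *)
definition axis_lowered ::
  "(real ^ 'n \<Rightarrow> real ^ 'n ^ 'n) \<Rightarrow> (real ^ 'n \<Rightarrow> real ^ 'n) \<Rightarrow>
   real ^ 'n \<Rightarrow> real ^ 'n \<Rightarrow> real ^ 'n \<Rightarrow> real ^ 'n::finite \<Rightarrow> real" where
  "axis_lowered g \<beta> x u w z = koszul g x u w z +
     covariant_form g \<beta> x u w * (\<beta> x \<bullet> z) - (\<beta> x \<bullet> w) * covariant_form g \<beta> x u z"

definition axis_connection ::
  "(real ^ 'n \<Rightarrow> real ^ 'n ^ 'n) \<Rightarrow> (real ^ 'n \<Rightarrow> real ^ 'n) \<Rightarrow>
   real ^ 'n \<Rightarrow> real ^ 'n \<Rightarrow> real ^ 'n \<Rightarrow> real ^ 'n::finite" where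
  "axis_connection g \<beta> x u w = sharp (g x) (axis_lowered g \<beta> x u w)"

text \<open>The coordinate picture on one open set, free of the manifold, so that two instances can
  be compared under a change of coordinates.\<close>

locale metric_and_form =
  fixes S :: "(real ^ 'n::finite) set"
    and g :: "real ^ 'n \<Rightarrow> real ^ 'n ^ 'n"
    and \<beta> :: "real ^ 'n \<Rightarrow> real ^ 'n"
  assumes open_S: "open S"
    and smooth_entry: "\<And>i j. smooth_on S (\<lambda>x. g x $ i $ j)"
    and smooth_form_entry: "\<And>i. smooth_on S (\<lambda>x. \<beta> x $ i)"
    and sym: "\<And>x y z. x \<in> S \<Longrightarrow> y \<bullet> (g x *v z) = z \<bullet> (g x *v y)"
    and pos: "\<And>x y. x \<in> S \<Longrightarrow> y \<noteq> 0 \<Longrightarrow> 0 < y \<bullet> (g x *v y)"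
    and unit: "\<And>x. x \<in> S \<Longrightarrow> \<beta> x \<bullet> (matrix_inv (g x) *v \<beta> x) = 1"
begin

lemma smooth_metric: "smooth_on S g"
  by (intro smooth_on_vec open_S smooth_entry)

lemma smooth_form: "smooth_on S \<beta>"
  by (intro smooth_on_vec open_S smooth_form_entry)

lemmas metric_has_derivative = smooth_on_has_derivative[OF smooth_metric]
lemmas form_has_derivative = smooth_on_has_derivative[OF smooth_form]

lemma invertible_metric:
  assumes "x \<in> S"
  shows "invertible (g x)"
proof -
  have "y = 0" if "g x *v y = 0" for y
    using pos[OF assms, of y] that by auto
  then show ?thesis
    by (auto simp: invertible_left_inverse matrix_left_invertible_ker)
qed

lemma sharp_inner:
  assumes "x \<in> S" "linear \<omega>"
  shows "sharp (g x) \<omega> \<bullet> (g x *v z) = \<omega> z"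
  using sym[OF assms(1), of "sharp (g x) \<omega>" z] linear_eq_inner[OF assms(2), of z]
  by (simp add: matrix_mult_sharp[OF invertible_metric[OF assms(1)]] inner_commute)

text \<open>Nondegeneracy of g: connection coefficients, which are defined by raising an index, are
  compared after lowering it again.\<close>

lemma metric_cancel:
  assumes "x \<in> S" "\<And>z. y \<bullet> (g x *v z) = y' \<bullet> (g x *v z)"
  shows "y = y'"
proof (rule ccontr)
  assume "y \<noteq> y'"
  then have "0 < (y - y') \<bullet> (g x *v (y - y'))" by (intro pos assms) auto
  then show False using assms(2) by (simp add: inner_diff_left)
qed

lemma linear_metric_derivative:
  assumes "x \<in> S"
  shows "linear (frechet_derivative g (at x))" "linear (frechet_derivative \<beta> (at x))"
  using metric_has_derivative[OF assms] form_has_derivative[OF assms] has_derivative_linear by blast+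

lemma linear_metric_deriv:
  assumes "x \<in> S"
  shows "linear (\<lambda>u. metric_deriv g x u w z)" "linear (\<lambda>w. metric_deriv g x u w z)"
    "linear (\<lambda>z. metric_deriv g x u w z)"
  using linear_metric_derivative[OF assms]
  by (auto intro!: linearI simp: metric_deriv_def linear_add linear_scale inner_add_left inner_add_right
      matrix_vector_mult_add_rdistrib matrix_vector_right_distrib
      scaleR_matrix_vector_assoc[symmetric] matrix_vector_mult_scaleR)

lemma metric_deriv_sym:
  assumes x: "x \<in> S"
  shows "metric_deriv g x u w z = metric_deriv g x u z w"
proof -
  have d: "((\<lambda>y. a \<bullet> (g y *v b)) has_derivative (\<lambda>u. metric_deriv g x u a b)) (at x)" for a b
    unfolding metric_deriv_def
    by (intro has_derivative_inner_right bounded_linear.has_derivative[OF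
          bounded_bilinear.bounded_linear_left[OF bounded_bilinear_matrix_vector_mult]]
        metric_has_derivative x)
  have "((\<lambda>y. w \<bullet> (g y *v z)) has_derivative (\<lambda>u. metric_deriv g x u z w)) (at x)"
    using has_derivative_cong_open[OF open_S x, of "\<lambda>y. w \<bullet> (g y *v z)" "\<lambda>y. z \<bullet> (g y *v w)"] sym d
    by blast
  from has_derivative_unique[OF d this] show ?thesis by metis
qed

lemma linear_koszul:
  assumes "x \<in> S"
  shows "linear (\<lambda>u. koszul g x u w z)" "linear (\<lambda>w. koszul g x u w z)" "linear (koszul g x u w)"
  using linear_metric_deriv[OF assms] unfolding linear_iff
  by (simp_all add: koszul_def field_simps)

lemma bilinear_levi_civita:
  assumes "x \<in> S"
  shows "linear (\<lambda>u. levi_civita g x u w)" "linear (levi_civita g x u)"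
  unfolding levi_civita_def using linear_koszul[OF assms] by (auto intro!: linear_sharp)

lemma levi_civita_inner:
  "x \<in> S \<Longrightarrow> levi_civita g x u w \<bullet> (g x *v z) = koszul g x u w z"
  by (simp add: levi_civita_def sharp_inner linear_koszul)

lemma bilinear_covariant_form:
  assumes "x \<in> S"
  shows "linear (\<lambda>u. covariant_form g \<beta> x u w)" "linear (covariant_form g \<beta> x u)"
  using linear_metric_derivative[OF assms] bilinear_levi_civita[OF assms] unfolding linear_iff
  by (simp_all add: covariant_form_def inner_add_left inner_add_right algebra_simps)

lemma linear_axis_lowered:
  assumes "x \<in> S"
  shows "linear (\<lambda>u. axis_lowered g \<beta> x u w z)" "linear (\<lambda>w. axis_lowered g \<beta> x u w z)"
    "linear (axis_lowered g \<beta> x u w)"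
  using linear_koszul[OF assms] bilinear_covariant_form[OF assms] unfolding linear_iff
  by (simp_all add: axis_lowered_def inner_add_right algebra_simps)

lemma bilinear_axis_connection:
  assumes "x \<in> S"
  shows "bilinear (axis_connection g \<beta> x)"
  unfolding bilinear_def axis_connection_def
  using linear_axis_lowered[OF assms] by (auto intro!: linear_sharp)

lemma axis_connection_inner:
  "x \<in> S \<Longrightarrow> axis_connection g \<beta> x u w \<bullet> (g x *v z) = axis_lowered g \<beta> x u w z"
  by (simp add: axis_connection_def sharp_inner linear_axis_lowered)

text \<open>The two correction terms are skew in the last two arguments and cancel in the sum; what
  remains is the metric compatibility contained in the Koszul expression.\<close>

lemma axis_connection_metric:
  assumes x: "x \<in> S"
  shows "metric_deriv g x u y z =
    axis_connection g \<beta> x u y \<bullet> (g x *v z) + y \<bullet> (g x *v axis_connection g \<beta> x u z)"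
  unfolding sym[OF x, of y "axis_connection g \<beta> x u z"] axis_connection_inner[OF x]
  using metric_deriv_sym[OF x, of y u z] metric_deriv_sym[OF x, of z u y] metric_deriv_sym[OF x, of u y z]
  by (simp add: axis_lowered_def koszul_def field_simps)

lemma smooth_axis_connection: "smooth_on S (\<lambda>x. axis_connection g \<beta> x u w)"
proof -
  have l: "bounded_linear (\<lambda>m. w \<bullet> (m *v z))" for w z :: "real ^ 'n"
    by (intro bounded_linear_compose[OF bounded_linear_inner_right
          bounded_bilinear.bounded_linear_left[OF bounded_bilinear_matrix_vector_mult]])
  have "smooth_on S (\<lambda>x. metric_deriv g x u w z)" for u w z
    unfolding metric_deriv_def
    by (rule smooth_on_bounded_linear[OF open_S l smooth_on_derivative[OF smooth_metric]])
  then have k: "smooth_on S (\<lambda>x. koszul g x u w z)" for u w z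
    unfolding koszul_def by (intro smooth_on_divide smooth_on_diff smooth_on_add open_S smooth_on_const) auto
  then have lc: "smooth_on S (\<lambda>x. levi_civita g x u w)" for u w
    unfolding levi_civita_def by (intro smooth_on_sharp open_S smooth_entry invertible_metric)
  note inner = smooth_on_bilinear[OF open_S bounded_bilinear_inner]
  have c: "smooth_on S (\<lambda>x. covariant_form g \<beta> x u w)" for u w
    unfolding covariant_form_def
    by (intro smooth_on_diff inner open_S smooth_on_const smooth_on_derivative smooth_form lc)
  have "smooth_on S (\<lambda>x. axis_lowered g \<beta> x u w z)" for u w z
    unfolding axis_lowered_def
    by (intro smooth_on_diff smooth_on_add smooth_on_mult inner open_S smooth_on_const smooth_form k c)
  then show ?thesis
    unfolding axis_connection_def by (intro smooth_on_sharp open_S smooth_entry invertible_metric)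
qed

lemma axis_vector_inner:
  "x \<in> S \<Longrightarrow> (matrix_inv (g x) *v \<beta> x) \<bullet> (g x *v z) = \<beta> x \<bullet> z"
  using sharp_inner[of x "(\<bullet>) (\<beta> x)" z]
  by (simp add: sharp_def bounded_linear.linear[OF bounded_linear_inner_right]
      inner_axis vec_lambda_eta)

text \<open>Unit length forces (D_u b)(b#) = 0. Evaluating the lowered coefficients at z = b# then
  kills the second correction term and turns the first into (D_u b)(w), exactly what Levi-Civita
  transport misses.\<close>

lemma axis_connection_form:
  assumes x: "x \<in> S"
  shows "frechet_derivative \<beta> (at x) u \<bullet> w = \<beta> x \<bullet> axis_connection g \<beta> x u w"
proof -
  define B where "B = (\<lambda>x. sharp (g x) ((\<bullet>) (\<beta> x)))"
  have lin: "linear ((\<bullet>) (\<beta> y))" for y by (rule bounded_linear.linear[OF bounded_linear_inner_right])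
  have B: "B y \<bullet> (g y *v z) = \<beta> y \<bullet> z" if "y \<in> S" for y z
    unfolding B_def using that lin by (rule sharp_inner)
  have B1: "\<beta> y \<bullet> B y = 1" if "y \<in> S" for y
    using unit[OF that] by (simp add: B_def sharp_def inner_axis vec_lambda_eta)
  have "smooth_on S B"
    unfolding B_def
    by (intro smooth_on_sharp open_S smooth_entry invertible_metric)
      (simp_all add: inner_axis smooth_form_entry)
  then obtain B' where B': "(B has_derivative B') (at x)"
    using smooth_on_has_derivative x by blast
  define b' g' where "b' = frechet_derivative \<beta> (at x)" and "g' = frechet_derivative g (at x)"
  have b': "(\<beta> has_derivative b') (at x)" unfolding b'_def by (rule form_has_derivative[OF x])
  have g': "(g has_derivative g') (at x)" unfolding g'_def by (rule metric_has_derivative[OF x])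
  \<comment> \<open>The dual field B satisfies both b(B) = 1 and g(B, B) = 1. Differentiating the
    two identities and eliminating the derivative of B yields the vanishing of (D_u b)(B).\<close>
  have "((\<lambda>y. \<beta> y \<bullet> B y) has_derivative (\<lambda>h. \<beta> x \<bullet> B' h + b' h \<bullet> B x)) (at x)"
    by (rule has_derivative_inner[OF b' B'])
  moreover have "((\<lambda>y. \<beta> y \<bullet> B y) has_derivative (\<lambda>h. 0)) (at x)"
    using has_derivative_cong_open[OF open_S x, of "\<lambda>y. \<beta> y \<bullet> B y" "\<lambda>_. 1"] B1 by auto
  ultimately have "(\<lambda>h. \<beta> x \<bullet> B' h + b' h \<bullet> B x) = (\<lambda>h. 0)" by (rule has_derivative_unique)
  then have 1: "\<beta> x \<bullet> B' u + b' u \<bullet> B x = 0" by metis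
  have "((\<lambda>y. B y \<bullet> (g y *v B y)) has_derivative
      (\<lambda>h. B x \<bullet> (g x *v B' h + g' h *v B x) + B' h \<bullet> (g x *v B x))) (at x)"
    by (rule has_derivative_inner[OF B' bounded_bilinear.FDERIV[OF bounded_bilinear_matrix_vector_mult g' B']])
  moreover have "((\<lambda>y. B y \<bullet> (g y *v B y)) has_derivative (\<lambda>h. 0)) (at x)"
    using has_derivative_cong_open[OF open_S x, of "\<lambda>y. B y \<bullet> (g y *v B y)" "\<lambda>_. 1"] B B1 by auto
  ultimately have "(\<lambda>h. B x \<bullet> (g x *v B' h + g' h *v B x) + B' h \<bullet> (g x *v B x)) = (\<lambda>h. 0)"
    by (rule has_derivative_unique)
  then have "B x \<bullet> (g x *v B' u + g' u *v B x) + B' u \<bullet> (g x *v B x) = 0" by metis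
  then have 2: "metric_deriv g x u (B x) (B x) + 2 * (\<beta> x \<bullet> B' u) = 0"
    using sym[OF x, of "B' u" "B x"] B[OF x, of "B' u"]
    by (simp add: metric_deriv_def g'_def inner_add_right)
  have lcB: "\<beta> x \<bullet> levi_civita g x u z = koszul g x u z (B x)" for z
    using B[OF x, of "levi_civita g x u z"] sym[OF x] levi_civita_inner[OF x, of u z "B x"] by metis
  have "koszul g x u (B x) (B x) = metric_deriv g x u (B x) (B x) / 2"
    using metric_deriv_sym[OF x] by (simp add: koszul_def)
  then have 3: "covariant_form g \<beta> x u (B x) = 0"
    using 1 2 lcB[of "B x"] by (simp add: covariant_form_def b'_def)
  have "\<beta> x \<bullet> axis_connection g \<beta> x u w = axis_lowered g \<beta> x u w (B x)"
    using B[OF x, of "axis_connection g \<beta> x u w"] sym[OF x] axis_connection_inner[OF x, of u w "B x"]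
    by metis
  also have "\<dots> = koszul g x u w (B x) + covariant_form g \<beta> x u w"
    by (simp add: axis_lowered_def B1[OF x] 3)
  also have "\<dots> = frechet_derivative \<beta> (at x) u \<bullet> w"
    by (simp add: covariant_form_def lcB)
  finally show ?thesis by simp
qed

end

section \<open>Behaviour under a change of coordinates\<close>

lemma frechet_derivative_nth:
  fixes f :: "'a::real_normed_vector \<Rightarrow> ('b::real_normed_vector) ^ 'n::finite"
  assumes "f differentiable (at x)"
  shows "frechet_derivative (\<lambda>y. f y $ i) (at x) v = frechet_derivative f (at x) v $ i"
proof -
  have "(f has_derivative frechet_derivative f (at x)) (at x)"
    using assms frechet_derivative_works by blast
  from frechet_derivative_at[OF bounded_linear.has_derivative[OF bounded_linear_vec_nth this]]
  show ?thesis by metis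
qed

lemma second_derivative_symmetric_vec:
  fixes T :: "'a::real_normed_vector \<Rightarrow> real ^ 'n::finite"
  assumes S: "open S" and T: "smooth_on S T" and x: "x \<in> S"
  shows "frechet_derivative (\<lambda>y. frechet_derivative T (at y) u) (at x) v =
    frechet_derivative (\<lambda>y. frechet_derivative T (at y) v) (at x) u"
proof -
  have e: "frechet_derivative (\<lambda>y. frechet_derivative T (at y) u) (at x) v $ i =
      frechet_derivative (\<lambda>y. frechet_derivative (\<lambda>z. T z $ i) (at y) u) (at x) v" for i u v
  proof -
    have "frechet_derivative (\<lambda>y. frechet_derivative (\<lambda>z. T z $ i) (at y) u) (at x) =
        frechet_derivative (\<lambda>y. frechet_derivative T (at y) u $ i) (at x)"
      by (intro frechet_derivative_cong_open[OF S x] frechet_derivative_nth smooth_on_differentiable[OF T])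
    then show ?thesis
      using frechet_derivative_nth[OF smooth_on_differentiable[OF smooth_on_derivative[OF T] x]] by metis
  qed
  show ?thesis
    unfolding vec_eq_iff e
    using second_derivative_symmetric[OF S smooth_on_nth[OF S T] x] by blast
qed

text \<open>Differentiating the pullback identities for metric and form produces second derivatives
  of T. They leave one inhomogeneous term in the Levi-Civita coefficients and cancel in the
  covariant derivative of the form, so the correction is a tensor and the corrected coefficients
  keep the same inhomogeneous term.\<close>

lemma axis_connection_transform:
  fixes T :: "real ^ 'n::finite \<Rightarrow> real ^ 'n"
  assumes G: "metric_and_form S g \<beta>" and G': "metric_and_form S' g' \<beta>'"
    and U: "open U" "U \<subseteq> S" "T ` U \<subseteq> S'" and T: "smooth_on U T"
    and g: "\<And>x y z. x \<in> U \<Longrightarrow> y \<bullet> (g x *v z) =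
      frechet_derivative T (at x) y \<bullet> (g' (T x) *v frechet_derivative T (at x) z)"
    and b: "\<And>x y. x \<in> U \<Longrightarrow> \<beta> x \<bullet> y = \<beta>' (T x) \<bullet> frechet_derivative T (at x) y"
    and x: "x \<in> U" and surj: "surj (frechet_derivative T (at x))"
  shows "axis_connection g' \<beta>' (T x) (frechet_derivative T (at x) u) (frechet_derivative T (at x) w) =
    frechet_derivative T (at x) (axis_connection g \<beta> x u w) -
    frechet_derivative (\<lambda>z. frechet_derivative T (at z) w) (at x) u"
proof -
  interpret G: metric_and_form S g \<beta> by (rule G)
  interpret G': metric_and_form S' g' \<beta>' by (rule G')
  have xS: "x \<in> S" and TS: "T x \<in> S'" using U x by auto
  define D where "D y = frechet_derivative T (at y)" for y
  define H where "H u w = frechet_derivative (\<lambda>z. D z w) (at x) u" for u w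
  have H: "((\<lambda>z. D z w) has_derivative (\<lambda>u. H u w)) (at x)" for w
    unfolding H_def D_def by (rule smooth_on_has_derivative[OF smooth_on_derivative[OF T] x])
  have Hsym: "H u w = H w u" for u w
    unfolding H_def D_def by (rule second_derivative_symmetric_vec[OF U(1) T x])
  have dT: "(T has_derivative D x) (at x)"
    unfolding D_def by (rule smooth_on_has_derivative[OF T x])
  note g = g[folded D_def] and b = b[folded D_def]
  have gx: "y \<bullet> (g x *v z) = D x y \<bullet> (g' (T x) *v D x z)" for y z using g[OF x] .
  have md: "metric_deriv g x u w z = metric_deriv g' (T x) (D x u) (D x w) (D x z)
      + D x w \<bullet> (g' (T x) *v H u z) + H u w \<bullet> (g' (T x) *v D x z)" for u w z
  proof -
    have "((\<lambda>y. w \<bullet> (g y *v z)) has_derivative (\<lambda>u. metric_deriv g x u w z)) (at x)"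
      unfolding metric_deriv_def
      by (intro has_derivative_inner_right bounded_linear.has_derivative[OF
            bounded_bilinear.bounded_linear_left[OF bounded_bilinear_matrix_vector_mult]]
          G.metric_has_derivative xS)
    moreover
    have "((\<lambda>y. D y w \<bullet> (g' (T y) *v D y z)) has_derivative
        (\<lambda>u. D x w \<bullet> (g' (T x) *v H u z + frechet_derivative g' (at (T x)) (D x u) *v D x z)
          + H u w \<bullet> (g' (T x) *v D x z))) (at x)"
      by (intro has_derivative_inner H bounded_bilinear.FDERIV[OF bounded_bilinear_matrix_vector_mult]
          has_derivative_compose[OF dT G'.metric_has_derivative[OF TS]])
    then have "((\<lambda>y. w \<bullet> (g y *v z)) has_derivative
        (\<lambda>u. D x w \<bullet> (g' (T x) *v H u z + frechet_derivative g' (at (T x)) (D x u) *v D x z)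
          + H u w \<bullet> (g' (T x) *v D x z))) (at x)"
      by (rule iffD2[OF has_derivative_cong_open[OF U(1) x], rotated]) (rule g)
    ultimately have "(\<lambda>u. metric_deriv g x u w z) =
        (\<lambda>u. D x w \<bullet> (g' (T x) *v H u z + frechet_derivative g' (at (T x)) (D x u) *v D x z)
          + H u w \<bullet> (g' (T x) *v D x z))" by (rule has_derivative_unique)
    from fun_cong[OF this, of u] show ?thesis
      by (simp add: metric_deriv_def inner_add_right)
  qed
  \<comment> \<open>Each metric derivative brings two second-derivative terms; by the symmetry of H
    and of the metric all of them cancel in the Koszul combination except H u w.\<close>
  have kz: "koszul g x u w z = koszul g' (T x) (D x u) (D x w) (D x z)
      + H u w \<bullet> (g' (T x) *v D x z)" for u w z
    unfolding koszul_def md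
    using G'.sym[OF TS, of "D x w" "H u z"] G'.sym[OF TS, of "D x u" "H w z"]
      Hsym[of w u] Hsym[of z u] Hsym[of z w]
      G'.sym[OF TS, of "D x u" "H z w"] G'.sym[OF TS, of "H u z" "D x w"]
    by (simp add: field_simps)
  \<comment> \<open>Every test vector in the target coordinates is an image \<open>D x z\<close>, so
    identities known for images determine vectors there.\<close>
  have surj_D: "\<exists>z. D x z = y" for y using surj unfolding D_def by (metis surjD)
  have lc: "levi_civita g' (T x) (D x u) (D x w) = D x (levi_civita g x u w) - H u w" for u w
  proof (rule G'.metric_cancel[OF TS])
    fix y
    obtain z where "D x z = y" using surj_D by blast
    then show "levi_civita g' (T x) (D x u) (D x w) \<bullet> (g' (T x) *v y) =
        (D x (levi_civita g x u w) - H u w) \<bullet> (g' (T x) *v y)"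
      using kz[of u w z] gx[of "levi_civita g x u w" z] G.levi_civita_inner[OF xS, of u w z]
      by (auto simp: G'.levi_civita_inner[OF TS] inner_diff_left)
  qed
  have fd: "frechet_derivative \<beta> (at x) u \<bullet> w =
      frechet_derivative \<beta>' (at (T x)) (D x u) \<bullet> D x w + \<beta>' (T x) \<bullet> H u w" for u w
  proof -
    have "((\<lambda>y. \<beta> y \<bullet> w) has_derivative (\<lambda>u. frechet_derivative \<beta> (at x) u \<bullet> w)) (at x)"
      by (intro has_derivative_inner_left G.form_has_derivative xS)
    moreover
    have "((\<lambda>y. \<beta>' (T y) \<bullet> D y w) has_derivative
        (\<lambda>u. \<beta>' (T x) \<bullet> H u w + frechet_derivative \<beta>' (at (T x)) (D x u) \<bullet> D x w)) (at x)"
      by (intro has_derivative_inner H has_derivative_compose[OF dT G'.form_has_derivative[OF TS]])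
    then have "((\<lambda>y. \<beta> y \<bullet> w) has_derivative
        (\<lambda>u. \<beta>' (T x) \<bullet> H u w + frechet_derivative \<beta>' (at (T x)) (D x u) \<bullet> D x w)) (at x)"
      by (rule iffD2[OF has_derivative_cong_open[OF U(1) x], rotated]) (rule b)
    ultimately have "(\<lambda>u. frechet_derivative \<beta> (at x) u \<bullet> w) =
        (\<lambda>u. \<beta>' (T x) \<bullet> H u w + frechet_derivative \<beta>' (at (T x)) (D x u) \<bullet> D x w)"
      by (rule has_derivative_unique)
    from fun_cong[OF this, of u] show ?thesis by simp
  qed
  \<comment> \<open>The H term from differentiating the form meets the H term of the Levi-Civita
    coefficients with opposite sign.\<close>
  have cf: "covariant_form g' \<beta>' (T x) (D x u) (D x w) = covariant_form g \<beta> x u w" for u w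
    unfolding covariant_form_def lc fd using b[OF x, of "levi_civita g x u w"]
    by (simp add: inner_diff_right)
  have al: "axis_lowered g' \<beta>' (T x) (D x u) (D x w) (D x z) =
      axis_lowered g \<beta> x u w z - H u w \<bullet> (g' (T x) *v D x z)" for z
    unfolding axis_lowered_def cf kz b[OF x] by simp
  have "axis_connection g' \<beta>' (T x) (D x u) (D x w) = D x (axis_connection g \<beta> x u w) - H u w"
  proof (rule G'.metric_cancel[OF TS])
    fix y
    obtain z where "D x z = y" using surj_D by blast
    then show "axis_connection g' \<beta>' (T x) (D x u) (D x w) \<bullet> (g' (T x) *v y) =
        (D x (axis_connection g \<beta> x u w) - H u w) \<bullet> (g' (T x) *v y)"
      using al[of z] gx[of "axis_connection g \<beta> x u w" z] G.axis_connection_inner[OF xS, of u w z]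
      by (auto simp: G'.axis_connection_inner[OF TS] inner_diff_left)
  qed
  then show ?thesis by (simp add: D_def H_def)
qed

section \<open>Charts and tangent vectors\<close>

lemma smooth_on_subset:
  assumes "smooth_on S f" "S' \<subseteq> S"
  shows "smooth_on S' f"
proof -
  have "Ck_on k S f \<Longrightarrow> Ck_on k S' f" for k
    using assms(2) by (induction k arbitrary: f) (auto intro: continuous_on_subset)
  then show ?thesis using assms(1) by (simp add: smooth_on_def)
qed

locale manifold =
  fixes A :: "('m::{t2_space, second_countable_topology}, 'n::finite) chart set"
  assumes atlas: "smooth_atlas A"
begin

lemma chart_homeo:
  assumes "c \<in> A"
  shows "open (fst c)" "open (chart_image c)"
    "continuous_on (fst c) (snd c)" "continuous_on (chart_image c) (chart_inv c)"
    "\<And>p. p \<in> fst c \<Longrightarrow> chart_inv c (snd c p) = p"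
    "\<And>x. x \<in> chart_image c \<Longrightarrow> snd c (chart_inv c x) = x"
    "\<And>p. p \<in> fst c \<Longrightarrow> snd c p \<in> chart_image c"
    "\<And>x. x \<in> chart_image c \<Longrightarrow> chart_inv c x \<in> fst c"
proof -
  have h: "open (fst c)" "open (chart_image c)"
    "homeomorphism (fst c) (chart_image c) (snd c) (chart_inv c)"
    using atlas assms unfolding smooth_atlas_def by blast+
  show "open (fst c)" "open (chart_image c)" by (fact h)+
  show "continuous_on (fst c) (snd c)" "continuous_on (chart_image c) (chart_inv c)"
    "\<And>p. p \<in> fst c \<Longrightarrow> chart_inv c (snd c p) = p"
    "\<And>x. x \<in> chart_image c \<Longrightarrow> snd c (chart_inv c x) = x"
    "\<And>p. p \<in> fst c \<Longrightarrow> snd c p \<in> chart_image c"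
    "\<And>x. x \<in> chart_image c \<Longrightarrow> chart_inv c x \<in> fst c"
    using h(3) unfolding homeomorphism_def by blast+
qed

lemma open_chart_subset:
  assumes c: "c \<in> A" and W: "open W" "W \<subseteq> fst c"
  shows "open (snd c ` W)"
proof -
  have "snd c ` W = chart_image c \<inter> chart_inv c -` W"
  proof (intro set_eqI iffI)
    fix x assume "x \<in> snd c ` W"
    then show "x \<in> chart_image c \<inter> chart_inv c -` W"
      using W(2) chart_homeo(5,7)[OF c] by auto
  next
    fix x assume "x \<in> chart_image c \<inter> chart_inv c -` W"
    then have "x = snd c (chart_inv c x)" "chart_inv c x \<in> W" by (simp_all add: chart_homeo(6)[OF c])
    then show "x \<in> snd c ` W" by (rule image_eqI)
  qed
  then show ?thesis
    using continuous_open_preimage[OF chart_homeo(4)[OF c] chart_homeo(2)[OF c] W(1)] by simp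
qed

lemma overlap_mem:
  assumes "c \<in> A"
  shows "x \<in> snd c ` (fst c \<inter> fst d) \<longleftrightarrow> x \<in> chart_image c \<and> chart_inv c x \<in> fst d"
  using chart_homeo(5-8)[OF assms] by (force simp: image_iff)

lemma open_overlap:
  assumes "c \<in> A" "d \<in> A"
  shows "open (snd c ` (fst c \<inter> fst d))"
  using assms by (intro open_chart_subset open_Int chart_homeo) auto

lemma smooth_transition:
  assumes "c \<in> A" "d \<in> A"
  shows "smooth_on (snd c ` (fst c \<inter> fst d)) (transition c d)"
  using atlas assms unfolding smooth_atlas_def by blast

lemma transition_apply:
  assumes "c \<in> A" "p \<in> fst c"
  shows "transition c d (snd c p) = snd d p"
  using chart_homeo(5)[OF assms] by (simp add: transition_def)

lemma transition_has_derivative: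
  assumes "c \<in> A" "d \<in> A" "p \<in> fst c" "p \<in> fst d"
  shows "(transition c d has_derivative frechet_derivative (transition c d) (at (snd c p))) (at (snd c p))"
  using assms by (intro smooth_on_has_derivative[OF smooth_transition[OF assms(1,2)]]) auto

lemma transition_chain:
  assumes A: "c \<in> A" "d \<in> A" "e \<in> A" and p: "p \<in> fst c" "p \<in> fst d" "p \<in> fst e"
  shows "frechet_derivative (transition c e) (at (snd c p)) y =
    frechet_derivative (transition d e) (at (snd d p)) (frechet_derivative (transition c d) (at (snd c p)) y)"
proof -
  define W where "W = snd c ` (fst c \<inter> fst d \<inter> fst e)"
  have W: "open W" "snd c p \<in> W"
    unfolding W_def using A p by (auto intro!: open_chart_subset open_Int chart_homeo)
  have tp: "transition c d (snd c p) = snd d p" by (rule transition_apply[OF A(1) p(1)])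
  have "((\<lambda>x. transition d e (transition c d x)) has_derivative
      (\<lambda>y. frechet_derivative (transition d e) (at (snd d p))
        (frechet_derivative (transition c d) (at (snd c p)) y))) (at (snd c p))"
    using has_derivative_compose[OF transition_has_derivative[OF A(1,2) p(1,2)]]
      transition_has_derivative[OF A(2,3) p(2,3)] unfolding tp by blast
  moreover have "transition d e (transition c d x) = transition c e x" if "x \<in> W" for x
    using that A by (auto simp: W_def transition_apply)
  ultimately have "(transition c e has_derivative
      (\<lambda>y. frechet_derivative (transition d e) (at (snd d p))
        (frechet_derivative (transition c d) (at (snd c p)) y))) (at (snd c p))"
    by (rule has_derivative_transform_within_open[OF _ W])
  from frechet_derivative_at[OF this] show ?thesis by metis
qed

lemma transition_self:
  assumes "c \<in> A" "p \<in> fst c"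
  shows "frechet_derivative (transition c c) (at (snd c p)) y = y"
proof -
  have "frechet_derivative (transition c c) (at (snd c p)) = frechet_derivative (\<lambda>x. x) (at (snd c p))"
    by (rule frechet_derivative_cong_open[OF chart_homeo(2)[OF assms(1)] chart_homeo(7)[OF assms]])
      (simp add: transition_def chart_homeo(6)[OF assms(1)])
  then show ?thesis by simp
qed

text \<open>The chain rule on the overlap makes the derivative of the reverse transition a right
  inverse.\<close>

lemma surj_transition_derivative:
  assumes "c \<in> A" "d \<in> A" "p \<in> fst c" "p \<in> fst d"
  shows "surj (frechet_derivative (transition c d) (at (snd c p)))"
  by (rule surjI[of _ "frechet_derivative (transition d c) (at (snd d p))"])
    (simp only: transition_chain[OF assms(2,1,2) assms(4,3,4), symmetric] transition_self[OF assms(2,4)])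

lemma tvec_apply:
  "d \<in> A \<Longrightarrow> p \<in> fst d \<Longrightarrow> tvec A c p y d = frechet_derivative (transition c d) (at (snd c p)) y"
  by (simp add: tvec_def)

lemma tvec_self: "c \<in> A \<Longrightarrow> p \<in> fst c \<Longrightarrow> tvec A c p y c = y"
  by (simp add: tvec_apply transition_self)

lemma tvec_mem:
  assumes "c \<in> A" "p \<in> fst c"
  shows "tvec A c p y \<in> tangent_space A p"
  unfolding tangent_space_def
proof (intro CollectI conjI allI ballI impI)
  fix d assume "\<not> (d \<in> A \<and> p \<in> fst d)"
  then show "tvec A c p y d = 0" by (auto simp: tvec_def)
next
  fix d e assume de: "d \<in> A" "e \<in> A" and p: "p \<in> fst d \<inter> fst e"
  then show "tvec A c p y e = frechet_derivative (transition d e) (at (snd d p)) (tvec A c p y d)"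
    unfolding tvec_def using transition_chain[OF assms(1) de assms(2)] by simp
qed

text \<open>The transition rule determines a tangent vector by its component in one chart. Together
  with \<open>tvec_self\<close> this identifies the tangent space with coordinate vectors.\<close>

lemma tvec_component:
  assumes "c \<in> A" "p \<in> fst c" "v \<in> tangent_space A p"
  shows "tvec A c p (v c) = v"
proof
  fix d
  show "tvec A c p (v c) d = v d"
  proof (cases "d \<in> A \<and> p \<in> fst d")
    case True
    then have "v d = frechet_derivative (transition c d) (at (snd c p)) (v c)"
      using assms unfolding tangent_space_def by blast
    then show ?thesis using True by (simp add: tvec_def)
  next
    case False
    then have "v d = 0" using assms(3) unfolding tangent_space_def by blast
    then show ?thesis using False by (auto simp: tvec_def)
  qed
qed

lemma tvec_transition:
  assumes "c \<in> A" "d \<in> A" "p \<in> fst c" "p \<in> fst d"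
  shows "tvec A d p (frechet_derivative (transition c d) (at (snd c p)) y) = tvec A c p y"
  using tvec_component[OF assms(2,4) tvec_mem[OF assms(1,3)], of y] assms by (simp add: tvec_apply)

lemma tvec_eq_0_iff:
  assumes "c \<in> A" "p \<in> fst c"
  shows "tvec A c p y = (\<lambda>_. 0) \<longleftrightarrow> y = 0"
proof
  assume "tvec A c p y = (\<lambda>_. 0)"
  then show "y = 0" using tvec_self[OF assms, of y] by simp
next
  assume y: "y = 0"
  show "tvec A c p y = (\<lambda>_. 0)"
  proof
    fix d
    show "tvec A c p y d = 0"
      using linear_0[OF has_derivative_linear[OF transition_has_derivative[OF assms(1) _ assms(2)]], of d]
      by (simp add: tvec_def y)
  qed
qed

end

section \<open>Metric and form in charts\<close>

lemma bilinear_eq_matrix: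
  fixes f :: "real ^ 'n::finite \<Rightarrow> real ^ 'n \<Rightarrow> real"
  assumes "bilinear f"
  shows "f y z = y \<bullet> ((\<chi> i j. f (axis i 1) (axis j 1)) *v z)"
proof -
  have l: "linear (\<lambda>y. f y z)" and r: "linear (f y)" for y z
    using assms by (simp_all add: bilinear_def)
  have "f (axis i 1) z = ((\<chi> i j. f (axis i 1) (axis j 1)) *v z) $ i" for i
    using linear_eq_inner[OF r, of "axis i 1" z] by (simp add: matrix_vector_mult_def inner_vec_def)
  then have "(\<chi> i. f (axis i 1) z) = (\<chi> i j. f (axis i 1) (axis j 1)) *v z"
    by (simp add: vec_eq_iff)
  then show ?thesis
    using linear_eq_inner[OF l, of y z] by (simp add: inner_commute)
qed

locale riemannian_form = manifold A
  for A :: "('m::{t2_space, second_countable_topology}, 'n::finite) chart set" +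
  fixes a :: "'m \<Rightarrow> ('m, 'n) tvector \<Rightarrow> ('m, 'n) tvector \<Rightarrow> real"
    and b :: "'m \<Rightarrow> ('m, 'n) tvector \<Rightarrow> real"
  assumes metric: "riemannian_metric A a" and form: "one_form A b" and unit: "unit_length A a b"
begin

lemma metric_tvec:
  assumes "c \<in> A" "p \<in> fst c"
  shows "a p (tvec A c p y) (tvec A c p z) = y \<bullet> (metric_comp A a c (snd c p) *v z)"
proof -
  have "bilinear (\<lambda>y z. a p (tvec A c p y) (tvec A c p z))"
    using metric assms unfolding riemannian_metric_def by blast
  from bilinear_eq_matrix[OF this, of y z] show ?thesis
    unfolding metric_comp_def chart_homeo(5)[OF assms] .
qed

lemma form_tvec:
  assumes "c \<in> A" "p \<in> fst c"
  shows "b p (tvec A c p y) = form_comp A b c (snd c p) \<bullet> y"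
proof -
  have "linear (\<lambda>y. b p (tvec A c p y))"
    using form assms unfolding one_form_def by blast
  from linear_eq_inner[OF this, of y] show ?thesis
    unfolding form_comp_def chart_homeo(5)[OF assms] .
qed

lemma chart_point:
  assumes "c \<in> A" "x \<in> chart_image c"
  obtains p where "p \<in> fst c" "x = snd c p" "p \<in> points A"
  using assms by (auto simp: chart_image_def points_def)

text \<open>The bridge to coordinates: the global axioms on a and b become matrix statements, with
  positivity carried over because only y = 0 represents the zero vector.\<close>

lemma local_data:
  assumes c: "c \<in> A"
  shows "metric_and_form (chart_image c) (metric_comp A a c) (form_comp A b c)"
proof
  show "open (chart_image c)" by (rule chart_homeo(2)[OF c])
  show "smooth_on (chart_image c) (\<lambda>x. metric_comp A a c x $ i $ j)" for i j
    using metric c unfolding riemannian_metric_def by blast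
  show "smooth_on (chart_image c) (\<lambda>x. form_comp A b c x $ i)" for i
    using form c unfolding one_form_def by blast
next
  fix x y z assume "x \<in> chart_image c"
  then obtain p where p: "p \<in> fst c" "x = snd c p" "p \<in> points A" by (rule chart_point[OF c])
  show "y \<bullet> (metric_comp A a c x *v z) = z \<bullet> (metric_comp A a c x *v y)"
    using metric p tvec_mem[OF c p(1)] unfolding riemannian_metric_def p(2) metric_tvec[OF c p(1), symmetric]
    by blast
next
  fix x y :: "real ^ 'n" assume "x \<in> chart_image c" and y: "y \<noteq> 0"
  then obtain p where p: "p \<in> fst c" "x = snd c p" "p \<in> points A" by (metis chart_point[OF c])
  show "0 < y \<bullet> (metric_comp A a c x *v y)"
    using metric p tvec_mem[OF c p(1)] y tvec_eq_0_iff[OF c p(1)]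
    unfolding riemannian_metric_def p(2) metric_tvec[OF c p(1), symmetric] by blast
next
  fix x assume "x \<in> chart_image c"
  then show "form_comp A b c x \<bullet> (matrix_inv (metric_comp A a c x) *v form_comp A b c x) = 1"
    using unit c unfolding unit_length_def
    by (simp add: inner_vec_def matrix_vector_mult_def sum_distrib_left mult_ac)
qed

text \<open>Built from a and b alone; the charge enters only when F is evaluated along a parallel
  field.\<close>

definition charge_connection ::
  "('m, 'n) chart \<Rightarrow> real ^ 'n \<Rightarrow> real ^ 'n \<Rightarrow> real ^ 'n \<Rightarrow> real ^ 'n" where
  "charge_connection c = axis_connection (metric_comp A a c) (form_comp A b c)"

text \<open>In both charts the components evaluate the same a and b on the same tangent vectors, so
  the transition map pulls metric and form back to each other, as the coordinate transformation law
  requires.\<close>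

lemma linear_charge_connection: "linear_connection A charge_connection"
  unfolding linear_connection_def
proof (intro conjI ballI allI)
  fix c assume c: "c \<in> A"
  interpret metric_and_form "chart_image c" "metric_comp A a c" "form_comp A b c" by (rule local_data[OF c])
  show "bilinear (charge_connection c x)" if "x \<in> chart_image c" for x
    unfolding charge_connection_def by (rule bilinear_axis_connection[OF that])
  show "smooth_on (chart_image c) (\<lambda>x. charge_connection c x u w)" for u w
    unfolding charge_connection_def by (rule smooth_axis_connection)
next
  fix c d x u w
  assume c: "c \<in> A" and d: "d \<in> A" and x: "x \<in> snd c ` (fst c \<inter> fst d)"
  then obtain p where p: "p \<in> fst c" "p \<in> fst d" "x = snd c p" by auto
  have T: "transition c d (snd c q) = snd d q" if "q \<in> fst c" for q
    by (rule transition_apply[OF c that])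
  show "let T = transition c d; DT = \<lambda>z. frechet_derivative T (at z)
      in charge_connection d (T x) (DT x u) (DT x w) =
        DT x (charge_connection c x u w) - frechet_derivative (\<lambda>z. DT z w) (at x) u"
    unfolding Let_def charge_connection_def
  proof (rule axis_connection_transform[OF local_data[OF c] local_data[OF d]
        open_overlap[OF c d] _ _ smooth_transition[OF c d] _ _ x])
    show "snd c ` (fst c \<inter> fst d) \<subseteq> chart_image c" by (auto simp: chart_image_def)
    show "transition c d ` snd c ` (fst c \<inter> fst d) \<subseteq> chart_image d"
      using T by (auto simp: chart_image_def)
    show "surj (frechet_derivative (transition c d) (at x))"
      using surj_transition_derivative[OF c d p(1,2)] p(3) by simp
  next
    fix x' y z assume "x' \<in> snd c ` (fst c \<inter> fst d)"
    then obtain q where q: "q \<in> fst c" "q \<in> fst d" and x': "x' = snd c q" by auto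
    show "y \<bullet> (metric_comp A a c x' *v z) = frechet_derivative (transition c d) (at x') y \<bullet>
        (metric_comp A a d (transition c d x') *v frechet_derivative (transition c d) (at x') z)"
      unfolding x' T[OF q(1)] metric_tvec[OF c q(1), symmetric] metric_tvec[OF d q(2), symmetric]
        tvec_transition[OF c d q] ..
  next
    fix x' y assume "x' \<in> snd c ` (fst c \<inter> fst d)"
    then obtain q where q: "q \<in> fst c" "q \<in> fst d" and x': "x' = snd c q" by auto
    show "form_comp A b c x' \<bullet> y =
        form_comp A b d (transition c d x') \<bullet> frechet_derivative (transition c d) (at x') y"
      unfolding x' T[OF q(1)] form_tvec[OF c q(1), symmetric] form_tvec[OF d q(2), symmetric]
        tvec_transition[OF c d q] ..
  qed
qed

text \<open>A curve need not stay in one chart, so only the vanishing of the derivatives of a(V, V)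
  and b(V) is checked in coordinates near each parameter; constancy then follows on the whole
  interval.\<close>

lemma parallel_preserves:
  assumes \<gamma>: "smooth_curve A J \<gamma>" and V: "parallel_along A charge_connection J \<gamma> V"
    and st: "s \<in> J" "t \<in> J"
  shows "a (\<gamma> s) (V s) (V s) = a (\<gamma> t) (V t) (V t)" "b (\<gamma> s) (V s) = b (\<gamma> t) (V t)"
proof -
  have J: "open J" "convex J"
    using \<gamma> is_interval_convex by (auto simp: smooth_curve_def)
  have d: "((\<lambda>r. a (\<gamma> r) (V r) (V r)) has_derivative (\<lambda>h. 0)) (at t) \<and>
      ((\<lambda>r. b (\<gamma> r) (V r)) has_derivative (\<lambda>h. 0)) (at t)" if t: "t \<in> J" for t
  proof -
    obtain c where c: "c \<in> A" and ct: "\<gamma> t \<in> fst c"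
      using \<gamma> t by (auto simp: smooth_curve_def points_def)
    interpret metric_and_form "chart_image c" "metric_comp A a c" "form_comp A b c" by (rule local_data[OF c])
    \<comment> \<open>The parameters whose points lie in the chart c; U is open, so the coordinate
      formulas hold near t and may be differentiated there.\<close>
    define U where "U = {r \<in> J. \<gamma> r \<in> fst c}"
    have "U = J \<inter> \<gamma> -` fst c" by (auto simp: U_def)
    then have U: "open U"
      using \<gamma> continuous_open_preimage[of J \<gamma> "fst c"] chart_homeo(1)[OF c] by (simp add: smooth_curve_def)
    have tU: "t \<in> U" using t ct by (simp add: U_def)
    define \<sigma> where "\<sigma> = (\<lambda>r. snd c (\<gamma> r))"
    define W where "W = (\<lambda>r. V r c)"
    define x where "x = \<sigma> t"
    have x: "x \<in> chart_image c" using chart_homeo(7)[OF c ct] by (simp add: x_def \<sigma>_def)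
    have "smooth_on U (snd c \<circ> \<gamma>)" using \<gamma> c by (simp add: smooth_curve_def U_def)
    then have "(snd c \<circ> \<gamma>) differentiable (at t)" using tU by (rule smooth_on_differentiable)
    then obtain h where h: "(\<sigma> has_vector_derivative h) (at t)" "vector_derivative (snd c \<circ> \<gamma>) (at t) = h"
      using vector_derivative_works by (auto simp: \<sigma>_def comp_def)
    define C where "C = axis_connection (metric_comp A a c) (form_comp A b c) x h (W t)"
    have W: "(W has_derivative (\<lambda>r. r *\<^sub>R - C)) (at t)"
      using V c t ct h(2)
      unfolding parallel_along_def has_vector_derivative_def C_def W_def x_def \<sigma>_def charge_connection_def
      by blast
    have s: "(\<sigma> has_derivative (\<lambda>r. r *\<^sub>R h)) (at t)" using h(1) by (simp add: has_vector_derivative_def)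
    have Vt: "V r = tvec A c (\<gamma> r) (W r)" if "r \<in> U" for r
      using that V tvec_component[OF c] unfolding U_def W_def parallel_along_def by fastforce
    have eq: "a (\<gamma> r) (V r) (V r) = W r \<bullet> (metric_comp A a c (\<sigma> r) *v W r)"
        "b (\<gamma> r) (V r) = form_comp A b c (\<sigma> r) \<bullet> W r" if "r \<in> U" for r
      using that metric_tvec[OF c] form_tvec[OF c] by (auto simp: Vt \<sigma>_def U_def)
    define g' b' where "g' = frechet_derivative (metric_comp A a c) (at x)"
      and "b' = frechet_derivative (form_comp A b c) (at x)"
    have lin: "linear g'" "linear b'" unfolding g'_def b'_def by (rule linear_metric_derivative[OF x])+
    have g': "((\<lambda>r. metric_comp A a c (\<sigma> r)) has_derivative (\<lambda>r. g' (r *\<^sub>R h))) (at t)"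
      using has_derivative_compose[OF s] metric_has_derivative[OF x] unfolding g'_def x_def by blast
    have b': "((\<lambda>r. form_comp A b c (\<sigma> r)) has_derivative (\<lambda>r. b' (r *\<^sub>R h))) (at t)"
      using has_derivative_compose[OF s] form_has_derivative[OF x] unfolding b'_def x_def by blast
    have "W t \<bullet> (g' h *v W t) = C \<bullet> (metric_comp A a c x *v W t) + W t \<bullet> (metric_comp A a c x *v C)"
      using axis_connection_metric[OF x, of h "W t" "W t"] by (simp add: metric_deriv_def g'_def C_def)
    \<comment> \<open>A parallel field has derivative -C, so the two connection terms enter with a
      minus sign and cancel the derivative of the metric.\<close>
    then have z1: "W t \<bullet> (metric_comp A a c (\<sigma> t) *v (r *\<^sub>R - C) + g' (r *\<^sub>R h) *v W t)
        + (r *\<^sub>R - C) \<bullet> (metric_comp A a c (\<sigma> t) *v W t) = 0" for r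
      by (simp add: x_def[symmetric] linear_scale[OF lin(1)] scaleR_matrix_vector_assoc[symmetric]
          matrix_vector_mult_scaleR inner_add_right algebra_simps)
        (simp add: linear_neg[OF matrix_vector_mul_linear] algebra_simps)
    have z2: "form_comp A b c (\<sigma> t) \<bullet> (r *\<^sub>R - C) + b' (r *\<^sub>R h) \<bullet> W t = 0" for r
      using axis_connection_form[OF x, of h "W t"]
      by (simp add: x_def[symmetric] C_def b'_def linear_scale[OF lin(2)[unfolded b'_def]])
    have "((\<lambda>r. W r \<bullet> (metric_comp A a c (\<sigma> r) *v W r)) has_derivative (\<lambda>r. 0)) (at t)"
      using has_derivative_inner[OF W bounded_bilinear.FDERIV[OF bounded_bilinear_matrix_vector_mult g' W]]
      unfolding z1 .
    moreover have "((\<lambda>r. form_comp A b c (\<sigma> r) \<bullet> W r) has_derivative (\<lambda>r. 0)) (at t)"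
      using has_derivative_inner[OF b' W] unfolding z2 .
    ultimately show ?thesis
      using eq by (auto intro: has_derivative_transform_within_open[OF _ U tU])
  qed
  have z: "f s = f t" if "\<And>t. t \<in> J \<Longrightarrow> (f has_derivative (\<lambda>h. 0)) (at t)" for f :: "real \<Rightarrow> real"
  proof -
    have "\<exists>c. \<forall>x\<in>J. f x = c"
      by (rule has_derivative_zero_constant[OF J(2)]) (auto intro: has_derivative_at_withinI that)
    then show ?thesis using st by auto
  qed
  show "a (\<gamma> s) (V s) (V s) = a (\<gamma> t) (V t) (V t)" "b (\<gamma> s) (V s) = b (\<gamma> t) (V t)"
    using d by (auto intro: z)
qed

end

section \<open>Short parallel transports\<close>

text \<open>Compactness bounds the finitely many values on pairs of basis vectors uniformly in x,
  and bilinearity extends the bound to all vectors.\<close>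

lemma bilinear_family_bounded:
  fixes G :: "'x::topological_space \<Rightarrow> 'a::euclidean_space \<Rightarrow> 'a \<Rightarrow> 'b::real_normed_vector"
  assumes D: "compact D" and bil: "\<And>x. x \<in> D \<Longrightarrow> bilinear (G x)"
    and cont: "\<And>u w. continuous_on D (\<lambda>x. G x u w)"
  obtains C where "0 \<le> C" "\<And>x u w. x \<in> D \<Longrightarrow> norm (G x u w) \<le> C * norm u * norm w"
proof -
  have "\<exists>B. \<forall>x\<in>D. norm (G x u w) \<le> B" for u w
    using compact_imp_bounded[OF compact_continuous_image[OF cont D]] by (auto simp: bounded_iff)
  then obtain B where B: "\<And>u w x. x \<in> D \<Longrightarrow> norm (G x u w) \<le> B u w" by metis
  define C where "C = (\<Sum>i\<in>Basis. \<Sum>j\<in>Basis. \<bar>B i j\<bar>)"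
  show ?thesis
  proof (rule that[of C])
    show "0 \<le> C" unfolding C_def by (intro sum_nonneg) auto
    fix x u w assume x: "x \<in> D"
    have l: "linear (\<lambda>u. G x u w)" "linear (G x u)" for u w using bil[OF x] by (simp_all add: bilinear_def)
    have "G x u w = G x (\<Sum>i\<in>Basis. (u \<bullet> i) *\<^sub>R i) (\<Sum>j\<in>Basis. (w \<bullet> j) *\<^sub>R j)"
      by (simp add: euclidean_representation)
    also have "\<dots> = (\<Sum>i\<in>Basis. (u \<bullet> i) *\<^sub>R G x i (\<Sum>j\<in>Basis. (w \<bullet> j) *\<^sub>R j))"
      by (simp only: linear_sum[OF l(1)] linear_scale[OF l(1)])
    also have "\<dots> = (\<Sum>i\<in>Basis. \<Sum>j\<in>Basis. (u \<bullet> i) *\<^sub>R (w \<bullet> j) *\<^sub>R G x i j)"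
      by (simp only: linear_sum[OF l(2)] linear_scale[OF l(2)] scaleR_sum_right)
    also have "norm \<dots> \<le> (\<Sum>i\<in>Basis. \<Sum>j\<in>Basis. \<bar>B i j\<bar> * norm u * norm w)"
    proof (intro sum_norm_le)
      fix i j :: 'a assume ij: "i \<in> Basis" "j \<in> Basis"
      have "norm ((u \<bullet> i) *\<^sub>R (w \<bullet> j) *\<^sub>R G x i j) = \<bar>u \<bullet> i\<bar> * (\<bar>w \<bullet> j\<bar> * norm (G x i j))" by (simp add: abs_mult)
      also have "\<dots> \<le> norm u * (norm w * \<bar>B i j\<bar>)"
        using ij B[OF x, of i j] by (intro mult_mono Basis_le_norm) auto
      finally show "norm ((u \<bullet> i) *\<^sub>R (w \<bullet> j) *\<^sub>R G x i j) \<le> \<bar>B i j\<bar> * norm u * norm w"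
        by (simp add: mult_ac)
    qed
    also have "\<dots> = C * norm u * norm w" by (simp add: C_def sum_distrib_right)
    finally show "norm (G x u w) \<le> C * norm u * norm w" .
  qed
qed

text \<open>Product rule for a Jacobian applied to a moving vector along a moving base point; it
  supplies the second-derivative term of the transformation law.\<close>

lemma tangent_map_has_vector_derivative:
  fixes T :: "real ^ 'n::finite \<Rightarrow> real ^ 'k::finite"
  assumes U: "open U" and T: "smooth_on U T" and l: "(l has_vector_derivative h) (at t)" "l t \<in> U"
    and W: "(W has_vector_derivative W') (at t)"
  shows "((\<lambda>r. frechet_derivative T (at (l r)) (W r)) has_vector_derivative
    (frechet_derivative (\<lambda>z. frechet_derivative T (at z) (W t)) (at (l t)) h +
     frechet_derivative T (at (l t)) W')) (at t)"
proof -
  \<comment> \<open>Smoothness of the derivative of T is available for each fixed vector only. As a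
    matrix it is a single smooth map, to which the bilinear product rule applies.\<close>
  define m where "m z = matrix (frechet_derivative T (at z))" for z
  have m: "m z *v w = frechet_derivative T (at z) w" if "z \<in> U" for z w
    unfolding m_def using that smooth_on_has_derivative[OF T] has_derivative_linear
    by (intro matrix_works) (auto simp: linear_matrix_vector_mul_eq)
  have "smooth_on U m"
    unfolding m_def matrix_def
    by (intro smooth_on_vec U) (simp add: smooth_on_nth[OF U smooth_on_derivative[OF T]])
  then obtain m' where m': "(m has_derivative m') (at (l t))"
    using smooth_on_has_derivative l(2) by blast
  have "((\<lambda>z. m z *v W t) has_derivative (\<lambda>h. m' h *v W t)) (at (l t))"
    by (rule bounded_linear.has_derivative[OF
          bounded_bilinear.bounded_linear_left[OF bounded_bilinear_matrix_vector_mult] m'])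
  then have "((\<lambda>z. frechet_derivative T (at z) (W t)) has_derivative (\<lambda>h. m' h *v W t)) (at (l t))"
    by (rule has_derivative_transform_within_open[OF _ U l(2) m])
  then have D2: "frechet_derivative (\<lambda>z. frechet_derivative T (at z) (W t)) (at (l t)) h = m' h *v W t"
    using frechet_derivative_at by metis
  have ld: "(l has_derivative (\<lambda>r. r *\<^sub>R h)) (at t)" and Wd: "(W has_derivative (\<lambda>r. r *\<^sub>R W')) (at t)"
    using l W by (simp_all add: has_vector_derivative_def)
  have "((\<lambda>r. m (l r) *v W r) has_derivative (\<lambda>r. m (l t) *v (r *\<^sub>R W') + m' (r *\<^sub>R h) *v W t)) (at t)"
    by (rule bounded_bilinear.FDERIV[OF bounded_bilinear_matrix_vector_mult has_derivative_compose[OF ld m'] Wd])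
  also have "(\<lambda>r. m (l t) *v (r *\<^sub>R W') + m' (r *\<^sub>R h) *v W t) = (\<lambda>r. r *\<^sub>R (m' h *v W t + m (l t) *v W'))"
    by (simp add: linear_scale[OF has_derivative_linear[OF m']] matrix_vector_mult_scaleR
        scaleR_matrix_vector_assoc[symmetric] scaleR_right_distrib add.commute)
  finally have v: "((\<lambda>r. m (l r) *v W r) has_vector_derivative (m' h *v W t + m (l t) *v W')) (at t)"
    by (simp add: has_vector_derivative_def)
  have "isCont l t" using l(1) has_derivative_continuous ld by blast
  then have "\<forall>\<^sub>F r in nhds t. l r \<in> U"
    using U l(2) by (simp add: isCont_def tendsto_at_iff_tendsto_nhds topological_tendstoD)
  then obtain N where N: "open N" "t \<in> N" "\<And>r. r \<in> N \<Longrightarrow> l r \<in> U"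
    by (auto simp: eventually_nhds)
  have "((\<lambda>r. frechet_derivative T (at (l r)) (W r)) has_vector_derivative
      (m' h *v W t + m (l t) *v W')) (at t)"
    by (rule has_vector_derivative_transform_within_open[OF v N(1,2)]) (simp add: m N(3))
  then show ?thesis by (simp add: D2 m l(2))
qed

section \<open>Parallel transport along coordinate segments\<close>

context manifold
begin

lemma smooth_curve_segment:
  assumes c: "c \<in> A" and J: "open J" "is_interval J" and im: "\<And>t. t \<in> J \<Longrightarrow> x + t *\<^sub>R h \<in> chart_image c"
  shows "smooth_curve A J (\<lambda>t. chart_inv c (x + t *\<^sub>R h))"
  unfolding smooth_curve_def
proof (intro conjI ballI J)
  show "(\<lambda>t. chart_inv c (x + t *\<^sub>R h)) ` J \<subseteq> points A"
    using c im chart_homeo(8)[OF c] by (auto simp: points_def)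
  show "continuous_on J (\<lambda>t. chart_inv c (x + t *\<^sub>R h))"
    by (rule continuous_on_compose2[OF chart_homeo(4)[OF c]]) (use im in \<open>auto intro!: continuous_intros\<close>)
  fix d assume d: "d \<in> A"
  \<comment> \<open>In another chart d the segment becomes the transition map restricted to a
    straight line.\<close>
  have "smooth_on {t. x + t *\<^sub>R h \<in> snd c ` (fst c \<inter> fst d)} (\<lambda>t. transition c d (x + t *\<^sub>R h))"
    by (rule smooth_on_affine_line[OF open_overlap[OF c d] smooth_transition[OF c d]])
  then have "smooth_on {t. x + t *\<^sub>R h \<in> snd c ` (fst c \<inter> fst d)} (snd d \<circ> (\<lambda>t. chart_inv c (x + t *\<^sub>R h)))"
    by (simp add: transition_def o_def)
  then show "smooth_on {t \<in> J. chart_inv c (x + t *\<^sub>R h) \<in> fst d} (snd d \<circ> (\<lambda>t. chart_inv c (x + t *\<^sub>R h)))"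
    by (rule smooth_on_subset) (auto simp: overlap_mem[OF c] im)
qed

text \<open>Solving the equation in the chart c is enough: in any other chart the second derivatives
  of the transition map cancel against the inhomogeneous term of the connection.\<close>

lemma parallel_along_segment:
  assumes G: "linear_connection A G" and c: "c \<in> A" and J: "open J"
    and im: "\<And>t. t \<in> J \<Longrightarrow> x + t *\<^sub>R h \<in> chart_image c"
    and W: "\<And>t. t \<in> J \<Longrightarrow> (W has_vector_derivative - G c (x + t *\<^sub>R h) h (W t)) (at t)"
  defines "\<gamma> \<equiv> (\<lambda>t. chart_inv c (x + t *\<^sub>R h))"
  shows "parallel_along A G J \<gamma> (\<lambda>t. tvec A c (\<gamma> t) (W t))"
  unfolding parallel_along_def
proof (intro conjI ballI impI)
  have \<gamma>: "\<gamma> t \<in> fst c" "snd c (\<gamma> t) = x + t *\<^sub>R h" if "t \<in> J" for t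
    using im[OF that] chart_homeo(6,8)[OF c] by (auto simp: \<gamma>_def)
  show "tvec A c (\<gamma> t) (W t) \<in> tangent_space A (\<gamma> t)" if "t \<in> J" for t
    using \<gamma>[OF that] by (intro tvec_mem c)
  fix d t assume d: "d \<in> A" and t: "t \<in> J" and dt: "\<gamma> t \<in> fst d"
  define T where "T = transition c d"
  define U where "U = snd c ` (fst c \<inter> fst d)"
  have U: "open U" "smooth_on U T" unfolding U_def T_def by (rule open_overlap[OF c d] smooth_transition[OF c d])+
  define l where "l = (\<lambda>r. x + r *\<^sub>R h)"
  have ld: "(l has_vector_derivative h) (at r)" for r
    unfolding l_def by (auto intro!: derivative_eq_intros)
  have lU: "l r \<in> U \<longleftrightarrow> \<gamma> r \<in> fst d" if "r \<in> J" for r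
    by (simp only: l_def U_def \<gamma>_def overlap_mem[OF c] im[OF that] simp_thms)
  have "continuous_on UNIV l" unfolding l_def by (intro continuous_intros)
  then have "open (l -` U)" using U(1) by (simp add: open_vimage)
  define N where "N = J \<inter> l -` U"
  have N: "open N" "t \<in> N" using J \<open>open (l -` U)\<close> t lU[OF t] dt by (auto simp: N_def)
  have snd_d: "snd d (\<gamma> r) = T (l r)" for r by (simp add: T_def transition_def l_def \<gamma>_def)
  have "(T has_derivative frechet_derivative T (at (l t))) (at (l t))"
    using smooth_on_has_derivative[OF U(2)] N(2) by (simp add: N_def)
  from vector_derivative_diff_chain_within[OF has_vector_derivative_at_within[OF ld] has_derivative_at_withinI[OF this], of UNIV]
  have "(T \<circ> l has_vector_derivative frechet_derivative T (at (l t)) h) (at t)" by simp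
  then have vd: "vector_derivative (snd d \<circ> \<gamma>) (at t) = frechet_derivative T (at (l t)) h"
    using snd_d by (intro vector_derivative_at) (simp add: comp_def)
  have "((\<lambda>r. frechet_derivative T (at (l r)) (W r)) has_vector_derivative
      (frechet_derivative (\<lambda>z. frechet_derivative T (at z) (W t)) (at (l t)) h +
       frechet_derivative T (at (l t)) (- G c (l t) h (W t)))) (at t)"
    using tangent_map_has_vector_derivative[OF U ld _ W[OF t]] N(2) by (simp add: N_def l_def)
  moreover have "frechet_derivative (\<lambda>z. frechet_derivative T (at z) (W t)) (at (l t)) h +
       frechet_derivative T (at (l t)) (- G c (l t) h (W t)) =
       - G d (T (l t)) (frechet_derivative T (at (l t)) h) (frechet_derivative T (at (l t)) (W t))"
  proof -
    have "l t \<in> snd c ` (fst c \<inter> fst d)" using N(2) by (simp add: N_def U_def)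
    then have "G d (T (l t)) (frechet_derivative T (at (l t)) h) (frechet_derivative T (at (l t)) (W t)) =
        frechet_derivative T (at (l t)) (G c (l t) h (W t)) -
        frechet_derivative (\<lambda>z. frechet_derivative T (at z) (W t)) (at (l t)) h"
      using G c d unfolding linear_connection_def T_def Let_def by blast
    moreover have "linear (frechet_derivative T (at (l t)))"
      using \<open>(T has_derivative frechet_derivative T (at (l t))) (at (l t))\<close> by (rule has_derivative_linear)
    ultimately show ?thesis by (simp add: linear_neg)
  qed
  ultimately have *: "((\<lambda>r. frechet_derivative T (at (l r)) (W r)) has_vector_derivative
      - G d (T (l t)) (frechet_derivative T (at (l t)) h) (frechet_derivative T (at (l t)) (W t))) (at t)"
    by simp
  have tv: "tvec A c (\<gamma> r) (W r) d = frechet_derivative T (at (l r)) (W r)" if "r \<in> N" for r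
  proof -
    have r: "r \<in> J" and dr: "\<gamma> r \<in> fst d" using that lU by (auto simp: N_def)
    show ?thesis by (simp add: tvec_apply[OF d dr] \<gamma>(2)[OF r] T_def l_def)
  qed
  show "((\<lambda>r. tvec A c (\<gamma> r) (W r) d) has_vector_derivative
      - G d (snd d (\<gamma> t)) (vector_derivative (snd d \<circ> \<gamma>) (at t)) (tvec A c (\<gamma> t) (W t) d)) (at t)"
    unfolding vd snd_d tv[OF N(2)]
    by (rule has_vector_derivative_transform_within_open[OF * N]) (simp add: tv)
qed

text \<open>The transport equation is linear, so one solution W and its negative carry y and -y
  simultaneously to y' and -y', which is what the reversal ratio needs. Both parameters s and t are
  free so that the segment can be used in either direction.\<close>

lemma local_transport:
  assumes F: "compatible_connection A F G" "linear_connection A G"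
    and c: "c \<in> A" and x: "x \<in> chart_image c"
  obtains \<delta> where "0 < \<delta>" and
    "\<forall>h. \<forall>s\<in>{0..1}. \<forall>t\<in>{0..1}. \<forall>y. norm h < \<delta> \<longrightarrow>
      x + s *\<^sub>R h \<in> chart_image c \<and> x + t *\<^sub>R h \<in> chart_image c \<and>
      (\<exists>y'. let p = chart_inv c (x + s *\<^sub>R h); q = chart_inv c (x + t *\<^sub>R h) in
        F q (tvec A c q y') = F p (tvec A c p y) \<and> F q (tvec A c q (- y')) = F p (tvec A c p (- y)))"
proof -
  obtain r where r: "r > 0" "cball x r \<subseteq> chart_image c"
    using open_contains_cball chart_homeo(2)[OF c] x by blast
  have bil: "bilinear (G c z)" if "z \<in> chart_image c" for z
    using F(2) c that unfolding linear_connection_def by blast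
  have cont: "continuous_on (chart_image c) (\<lambda>z. G c z u w)" for u w
    using F(2) c unfolding linear_connection_def by (blast intro: smooth_on_continuous_on)
  obtain C where C: "0 \<le> C" "\<And>z u w. z \<in> cball x r \<Longrightarrow> norm (G c z u w) \<le> C * norm u * norm w"
    using bilinear_family_bounded[of "cball x r" "G c"] bil cont continuous_on_subset r(2)
    by (metis compact_cball subsetD)
  \<comment> \<open>With r / 2 the parameters from -1 to 2 keep the segment in the ball of radius r.
    The 12 makes the contraction factor 2 * C * norm h * 3 at most 1/2, where 3 is the length of
    that interval; C + 1 avoids division by zero.\<close>
  define \<delta> where "\<delta> = min (r / 2) (1 / (12 * (C + 1)))"
  have \<delta>: "0 < \<delta>" using r C by (simp add: \<delta>_def)
  show ?thesis
  proof (rule that[OF \<delta>], intro allI ballI impI)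
    fix s t and h y :: "real ^ 'n"
    assume h: "norm h < \<delta>" and s: "s \<in> {0..1::real}" and t: "t \<in> {0..1::real}"
    define \<gamma> where "\<gamma> = (\<lambda>t. chart_inv c (x + t *\<^sub>R h))"
    \<comment> \<open>The interval extends beyond [0, 1] because curves live on open intervals and
      the solution is differentiated only at interior parameters.\<close>
    have ball: "x + t *\<^sub>R h \<in> cball x r" if "t \<in> {-1..2}" for t
    proof -
      have "norm (t *\<^sub>R h) \<le> 2 * (r / 2)"
        unfolding norm_scaleR using that h by (intro mult_mono) (auto simp: \<delta>_def)
      then show ?thesis by (simp add: dist_norm)
    qed
    have im: "x + t *\<^sub>R h \<in> chart_image c" if "t \<in> {-1..2}" for t using ball[OF that] r(2) by blast
    have small: "2 * (C * norm h * (2 - - 1)) < 1"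
    proof -
      have "C * norm h \<le> C * (1 / (12 * (C + 1)))"
        using h C(1) by (intro mult_left_mono) (auto simp: \<delta>_def)
      also have "\<dots> \<le> 1 / 12" using C(1) by (simp add: field_simps)
      finally show ?thesis by simp
    qed
    have "\<exists>W. W s = y \<and> (\<forall>t\<in>{-1<..<2}. (W has_vector_derivative - G c (x + t *\<^sub>R h) h (W t)) (at t))"
    proof -
      obtain W where "W s = y"
        "\<And>t. t \<in> {-1<..<2} \<Longrightarrow> (W has_vector_derivative - G c (x + t *\<^sub>R h) h (W t)) (at t)"
      proof (rule linear_ode_solution[of s "-1" 2 "\<lambda>t w. - G c (x + t *\<^sub>R h) h w" "C * norm h" y])
        show "s \<in> {-1..2}" using s by auto
        show "continuous_on {-1..2} (\<lambda>t. - G c (x + t *\<^sub>R h) h v)" for v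
          by (intro continuous_on_minus continuous_on_compose2[OF cont])
            (use im in \<open>auto intro!: continuous_intros\<close>)
        show "linear (\<lambda>w. - G c (x + t *\<^sub>R h) h w)" if "t \<in> {-1..2}" for t
          using bil[OF im[OF that]] by (auto simp: bilinear_def intro: linear_compose_neg)
        show "norm (- G c (x + t *\<^sub>R h) h v) \<le> C * norm h * norm v" if "t \<in> {-1..2}" for t v
          using C(2)[OF ball[OF that]] by simp
        show "0 \<le> C * norm h" using C(1) by simp
      qed (use small in auto)
      then show ?thesis by blast
    qed
    then obtain W where W: "W s = y"
      "\<And>t. t \<in> {-1<..<2} \<Longrightarrow> (W has_vector_derivative - G c (x + t *\<^sub>R h) h (W t)) (at t)" by blast
    have W_neg: "((\<lambda>t. - W t) has_vector_derivative - G c (x + t *\<^sub>R h) h (- W t)) (at t)"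
      if "t \<in> {-1<..<2}" for t
    proof -
      have "linear (G c (x + t *\<^sub>R h) h)"
        using bil[OF im] that by (simp add: bilinear_def)
      then show ?thesis
        using has_vector_derivative_minus[OF W(2)[OF that]] by (simp add: linear_neg)
    qed
    have curve: "smooth_curve A {-1<..<2} \<gamma>"
      unfolding \<gamma>_def by (rule smooth_curve_segment[OF c]) (use im in \<open>auto simp: is_interval_oo\<close>)
    have st: "s \<in> {-1<..<2}" "t \<in> {-1<..<2}" using s t by auto
    have pres: "F (\<gamma> t) (tvec A c (\<gamma> t) (X t)) = F (\<gamma> s) (tvec A c (\<gamma> s) (X s))"
      if "\<And>t. t \<in> {-1<..<2} \<Longrightarrow> (X has_vector_derivative - G c (x + t *\<^sub>R h) h (X t)) (at t)" for X
    proof -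
      have "parallel_along A G {-1<..<2} \<gamma> (\<lambda>t. tvec A c (\<gamma> t) (X t))"
        unfolding \<gamma>_def by (rule parallel_along_segment[OF F(2) c _ _ that]) (use im in auto)
      then have "parallel_transport A G {-1<..<2} \<gamma> s t (tvec A c (\<gamma> s) (X s)) (tvec A c (\<gamma> t) (X t))"
        unfolding parallel_transport_def by blast
      then show ?thesis using F(1) curve st unfolding compatible_connection_def by blast
    qed
    show "x + s *\<^sub>R h \<in> chart_image c \<and> x + t *\<^sub>R h \<in> chart_image c \<and>
      (\<exists>y'. let p = chart_inv c (x + s *\<^sub>R h); q = chart_inv c (x + t *\<^sub>R h) in
        F q (tvec A c q y') = F p (tvec A c p y) \<and> F q (tvec A c q (- y')) = F p (tvec A c p (- y)))"
      using pres[OF W(2)] pres[OF W_neg] im s t unfolding Let_def \<gamma>_def W(1)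
      by (intro conjI exI[of _ "W t"]) auto
  qed
qed

end

section \<open>Finsleroid-Finsler metrics\<close>

context riemannian_form
begin

text \<open>The a-dual of b; the unit length condition on b is precisely its normalisation.\<close>

lemma axis_vector:
  assumes c: "c \<in> A" and p: "p \<in> fst c"
  obtains y where "\<forall>z. a p (tvec A c p y) (tvec A c p z) = b p (tvec A c p z)"
    and "a p (tvec A c p y) (tvec A c p y) = 1" and "b p (tvec A c p y) = 1"
proof -
  interpret metric_and_form "chart_image c" "metric_comp A a c" "form_comp A b c" by (rule local_data[OF c])
  define x where "x = snd c p"
  have x: "x \<in> chart_image c" using chart_homeo(7)[OF c p] by (simp add: x_def)
  define y where "y = matrix_inv (metric_comp A a c x) *v form_comp A b c x"
  have 1: "a p (tvec A c p y) (tvec A c p z) = b p (tvec A c p z)" for z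
    using axis_vector_inner[OF x, of z]
    by (simp add: y_def metric_tvec[OF c p] form_tvec[OF c p] x_def)
  have 2: "b p (tvec A c p y) = 1"
    using unit[OF x] by (simp add: y_def form_tvec[OF c p] x_def)
  show ?thesis using that[of y] 1 2 by simp
qed

lemma metric_nonneg:
  assumes "p \<in> points A" "v \<in> tangent_space A p"
  shows "0 \<le> a p v v" "a p v v = 0 \<longleftrightarrow> v = (\<lambda>_. 0)"
proof -
  obtain c where c: "c \<in> A" "p \<in> fst c" using assms(1) by (auto simp: points_def)
  have 0: "a p v v = 0" if "v = (\<lambda>_. 0)"
    using metric_tvec[OF c, of 0 0] tvec_eq_0_iff[OF c, of 0] that by simp
  moreover have pos: "a p v v > 0" if "v \<noteq> (\<lambda>_. 0)"
    using metric assms that unfolding riemannian_metric_def by blast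
  ultimately show "0 \<le> a p v v" "a p v v = 0 \<longleftrightarrow> v = (\<lambda>_. 0)" by force+
qed

text \<open>Cauchy-Schwarz against the unit axis vector y: with t = b(z), the nonnegative square of
  z - t y expands to a(z, z) - t^2. It makes the argument of the square root in the energy
  nonnegative.\<close>

lemma form_square_le:
  assumes c: "c \<in> A" and p: "p \<in> fst c"
  shows "(b p (tvec A c p z))\<^sup>2 \<le> a p (tvec A c p z) (tvec A c p z)"
proof -
  obtain y where y: "\<forall>z. a p (tvec A c p y) (tvec A c p z) = b p (tvec A c p z)"
    "a p (tvec A c p y) (tvec A c p y) = 1" "b p (tvec A c p y) = 1"
    by (rule axis_vector[OF c p])
  interpret metric_and_form "chart_image c" "metric_comp A a c" "form_comp A b c" by (rule local_data[OF c])
  define m where "m = metric_comp A a c (snd c p)"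
  define t where "t = b p (tvec A c p z)"
  have pp: "p \<in> points A" using c p by (auto simp: points_def)
  have "0 \<le> (z - t *\<^sub>R y) \<bullet> (m *v (z - t *\<^sub>R y))"
    using metric_nonneg(1)[OF pp tvec_mem[OF c p]] by (simp add: m_def metric_tvec[OF c p])
  also have "\<dots> = z \<bullet> (m *v z) - t * (z \<bullet> (m *v y)) - t * (y \<bullet> (m *v z)) + t * t * (y \<bullet> (m *v y))"
    by (simp add: linear_diff[OF matrix_vector_mul_linear] matrix_vector_mult_scaleR inner_diff_left
        inner_diff_right algebra_simps)
  also have "z \<bullet> (m *v y) = y \<bullet> (m *v z)"
    unfolding m_def by (rule sym[OF chart_homeo(7)[OF c p]])
  also have "y \<bullet> (m *v z) = t" using y(1) by (simp add: m_def t_def metric_tvec[OF c p])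
  also have "y \<bullet> (m *v y) = 1" using y(2) by (simp add: m_def metric_tvec[OF c p])
  finally show ?thesis
    by (simp add: m_def t_def metric_tvec[OF c p] power2_eq_square)
qed

text \<open>The zero vector is recognised by a(v, v) = 0, so the energy is a function of K(p), a(v,
  v) and b(v): equality of these three numbers gives equality of energies.\<close>

lemma finsleroid_energy_eq:
  assumes "p \<in> points A" "v \<in> tangent_space A p"
  shows "finsleroid_energy a b K p v =
    (if a p v v = 0 then 0 else energy_profile (K p) (a p v v) (b p v))"
  using metric_nonneg[OF assms]
  by (simp add: finsleroid_energy_def energy_profile_def Let_def)

text \<open>Bound and attainment together make R the maximum of the energy ratio over nonzero y; it
  is the square of the corresponding ratio for F.\<close>

lemma finsleroid_energy_reversal:
  assumes c: "c \<in> A" and p: "p \<in> fst c" and K: "\<bar>K p\<bar> < 4"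
  defines "e \<equiv> (\<lambda>y. finsleroid_energy a b K p (tvec A c p y))"
    and "R \<equiv> exp (2 * pi * \<bar>K p\<bar> / sqrt (16 - (K p)\<^sup>2))"
  shows "e y \<le> e (- y) * R" and "\<exists>y. e y = e (- y) * R \<and> 0 < e (- y)"
proof -
  have pp: "p \<in> points A" using c p by (auto simp: points_def)
  define \<alpha> \<beta> where "\<alpha> = (\<lambda>y. a p (tvec A c p y) (tvec A c p y))" and "\<beta> = (\<lambda>y. b p (tvec A c p y))"
  have e: "e y = (if \<alpha> y = 0 then 0 else energy_profile (K p) (\<alpha> y) (\<beta> y))" for y
    using finsleroid_energy_eq[OF pp tvec_mem[OF c p]] by (simp add: e_def \<alpha>_def \<beta>_def)
  have minus: "\<alpha> (- y) = \<alpha> y" "\<beta> (- y) = - \<beta> y" for y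
    by (simp_all add: \<alpha>_def \<beta>_def metric_tvec[OF c p] form_tvec[OF c p]
        linear_neg[OF matrix_vector_mul_linear])
  have \<alpha>: "0 \<le> \<alpha> y" "(\<beta> y)\<^sup>2 \<le> \<alpha> y" for y
    using metric_nonneg(1)[OF pp tvec_mem[OF c p]] form_square_le[OF c p] by (simp_all add: \<alpha>_def \<beta>_def)
  show "e y \<le> e (- y) * R"
    using energy_profile_reversal_le[OF K \<alpha>(2)[of y]] \<alpha>(1)[of y] by (simp add: e minus R_def)
  obtain z where z: "\<alpha> z = 1" "\<beta> z = 1"
    using axis_vector[OF c p] unfolding \<alpha>_def \<beta>_def by metis
  \<comment> \<open>The orientation along the axis that makes the exponent nonnegative, so that |K|
    appears.\<close>
  define y where "y = (if 0 \<le> K p then z else - z)"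
  have "e y = e (- y) * R"
    using energy_profile_axis[of "K p"] by (simp add: y_def e minus z R_def)
  moreover have "0 < e (- y)"
    using energy_profile_pos[OF K, of _ 1] by (simp add: y_def e minus z)
  ultimately show "\<exists>y. e y = e (- y) * R \<and> 0 < e (- y)" by blast
qed

text \<open>An extremal y at p is carried to some y' with the same reversal ratio, which cannot
  exceed the maximum at q. Only this one direction of transport is used; the reverse inequality
  comes from exchanging p and q.\<close>

lemma abs_charge_le:
  assumes c: "c \<in> A" and p: "p \<in> fst c" and q: "q \<in> fst c" and K: "\<bar>K p\<bar> < 4" "\<bar>K q\<bar> < 4"
    and tr: "\<And>y. \<exists>y'. finsleroid_metric a b K q (tvec A c q y') = finsleroid_metric a b K p (tvec A c p y) \<and>
      finsleroid_metric a b K q (tvec A c q (- y')) = finsleroid_metric a b K p (tvec A c p (- y))"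
  shows "\<bar>K p\<bar> \<le> \<bar>K q\<bar>"
proof -
  define e where "e = (\<lambda>r y. finsleroid_energy a b K r (tvec A c r y))"
  define R where "R = (\<lambda>r. 2 * pi * \<bar>K r\<bar> / sqrt (16 - (K r)\<^sup>2))"
  obtain y where y: "e p y = e p (- y) * exp (R p)" "0 < e p (- y)"
    using finsleroid_energy_reversal(2)[where K = K, OF c p K(1)] unfolding e_def R_def by blast
  obtain y' where
    "finsleroid_metric a b K q (tvec A c q y') = finsleroid_metric a b K p (tvec A c p y)"
    "finsleroid_metric a b K q (tvec A c q (- y')) = finsleroid_metric a b K p (tvec A c p (- y))"
    using tr[of y] by blast
  \<comment> \<open>The real square root is injective on the whole line, so equal lengths give equal
    energies without a sign check.\<close>
  then have y': "e q y' = e p y" "e q (- y') = e p (- y)"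
    by (simp_all add: finsleroid_metric_def e_def)
  have "e q y' \<le> e q (- y') * exp (R q)"
    using finsleroid_energy_reversal(1)[where K = K, OF c q K(2)] unfolding e_def R_def by blast
  then have "e p (- y) * exp (R p) \<le> e p (- y) * exp (R q)"
    by (simp only: y' y(1))
  then have "R p \<le> R q" using y(2) by simp
  then have "2 * pi * (\<bar>K p\<bar> / sqrt (16 - \<bar>K p\<bar>\<^sup>2)) \<le> 2 * pi * (\<bar>K q\<bar> / sqrt (16 - \<bar>K q\<bar>\<^sup>2))"
    by (simp add: R_def)
  then have "\<bar>K p\<bar> / sqrt (16 - \<bar>K p\<bar>\<^sup>2) \<le> \<bar>K q\<bar> / sqrt (16 - \<bar>K q\<bar>\<^sup>2)"
    by (rule mult_left_le_imp_le) simp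
  then show ?thesis
    by (rule charge_ratio_le_imp_le[OF abs_ge_zero K(1) abs_ge_zero K(2)])
qed

text \<open>Local constancy is proved for |K| only; K then takes at most two values, and a
  continuous function with finite range on a connected set is constant.\<close>

lemma generalized_berwald_imp_constant:
  assumes conn: "connected (points A)" and sm: "smooth_function A K"
    and K: "K ` points A \<subseteq> {-4<..<4}"
    and gb: "generalized_berwald A (finsleroid_metric a b K)"
  shows "K constant_on points A"
proof -
  obtain G where G: "compatible_connection A (finsleroid_metric a b K) G" "linear_connection A G"
    using gb unfolding generalized_berwald_def by blast
  have K4: "\<bar>K p\<bar> < 4" if "c \<in> A" "p \<in> fst c" for p c
    using K that by (force simp: points_def abs_less_iff)
  have "\<forall>p\<in>points A. \<forall>\<^sub>F q in at p within points A. \<bar>K p\<bar> = \<bar>K q\<bar>"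
  proof
    fix p assume "p \<in> points A"
    then obtain c where c: "c \<in> A" and p: "p \<in> fst c" by (auto simp: points_def)
    define x where "x = snd c p"
    have x: "x \<in> chart_image c" "chart_inv c x = p"
      using chart_homeo(5,7)[OF c p] by (simp_all add: x_def)
    obtain \<delta> where \<delta>: "0 < \<delta>" and
      tr: "\<forall>h. \<forall>s\<in>{0..1}. \<forall>t\<in>{0..1}. \<forall>y. norm h < \<delta> \<longrightarrow>
        x + s *\<^sub>R h \<in> chart_image c \<and> x + t *\<^sub>R h \<in> chart_image c \<and>
        (\<exists>y'. let p = chart_inv c (x + s *\<^sub>R h); q = chart_inv c (x + t *\<^sub>R h) in
          finsleroid_metric a b K q (tvec A c q y') = finsleroid_metric a b K p (tvec A c p y) \<and>
          finsleroid_metric a b K q (tvec A c q (- y')) = finsleroid_metric a b K p (tvec A c p (- y)))"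
      by (rule local_transport[OF G c x(1)])
    have eq: "\<bar>K p\<bar> = \<bar>K q\<bar>" if q: "q \<in> fst c" "snd c q \<in> ball x \<delta>" for q
    proof -
      define h where "h = snd c q - x"
      have h: "norm h < \<delta>" using q(2) by (simp add: h_def dist_norm norm_minus_commute)
      have xh: "chart_inv c (x + h) = q" using chart_homeo(5)[OF c q(1)] by (simp add: h_def)
      show ?thesis
      \<comment> \<open>The same segment is traversed once from p to q and once from q to p.\<close>
      proof (rule antisym)
        show "\<bar>K p\<bar> \<le> \<bar>K q\<bar>"
          using tr[rule_format, of 0 1 h] h by (intro abs_charge_le[OF c p q(1)] K4[OF c] p q) (simp_all add: Let_def x xh)
        show "\<bar>K q\<bar> \<le> \<bar>K p\<bar>"
          using tr[rule_format, of 1 0 h] h by (intro abs_charge_le[OF c q(1) p] K4[OF c] p q) (simp_all add: Let_def x xh)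
      qed
    qed
    define N where "N = fst c \<inter> snd c -` ball x \<delta>"
    have "open N"
      unfolding N_def by (rule continuous_open_preimage[OF chart_homeo(3,1)[OF c] open_ball])
    moreover have "p \<in> N" using p \<delta> by (simp add: N_def x_def)
    moreover have "\<bar>K p\<bar> = \<bar>K q\<bar>" if "q \<in> N" for q
      by (rule eq) (use that in \<open>auto simp: N_def\<close>)
    ultimately show "\<forall>\<^sub>F q in at p within points A. \<bar>K p\<bar> = \<bar>K q\<bar>"
      unfolding eventually_at_topological by blast
  qed
  then have abs_const: "\<bar>K p\<bar> = \<bar>K q\<bar>" if "p \<in> points A" "q \<in> points A" for p q
    using connected_local_const[OF conn that, of "\<lambda>p. \<bar>K p\<bar>"] by blast
  have "continuous_on (points A) K"
    unfolding points_def
  proof (rule continuous_on_open_UN)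
    fix c assume c: "c \<in> A"
    show "open (fst c)" by (rule chart_homeo(1)[OF c])
    have "continuous_on (chart_image c) (K \<circ> chart_inv c)"
      using sm c unfolding smooth_function_def by (blast intro: smooth_on_continuous_on)
    then have "continuous_on (fst c) (\<lambda>p. (K \<circ> chart_inv c) (snd c p))"
      by (rule continuous_on_compose2[OF _ chart_homeo(3)[OF c]]) (auto simp: chart_image_def)
    then show "continuous_on (fst c) K"
      by (rule continuous_on_eq) (simp add: chart_homeo(5)[OF c])
  qed
  \<comment> \<open>The manifold may be empty, so a reference point for the two candidate values is
    available only in one case.\<close>
  moreover have "finite (K ` points A)"
  proof (cases "points A = {}")
    case False
    then obtain p where p: "p \<in> points A" by blast
    have "K ` points A \<subseteq> {\<bar>K p\<bar>, - \<bar>K p\<bar>}"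
    proof
      fix k assume "k \<in> K ` points A"
      then have "\<bar>k\<bar> = \<bar>K p\<bar>" using abs_const[OF _ p] by blast
      then show "k \<in> {\<bar>K p\<bar>, - \<bar>K p\<bar>}" by auto
    qed
    then show ?thesis by (rule finite_subset) simp
  qed simp
  ultimately show ?thesis using continuous_finite_range_constant[OF conn] by blast
qed

text \<open>Transport by the corrected connection preserves a(v, v) and b(v), and constancy of K
  supplies the third argument of the energy.\<close>

lemma constant_imp_generalized_berwald:
  assumes "K constant_on points A"
  shows "generalized_berwald A (finsleroid_metric a b K)"
  unfolding generalized_berwald_def
proof (intro exI conjI)
  show "linear_connection A charge_connection" by (rule linear_charge_connection)
  show "compatible_connection A (finsleroid_metric a b K) charge_connection"
    unfolding compatible_connection_def
  proof (intro allI impI)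
    fix J \<gamma> s t v w
    assume \<gamma>: "smooth_curve A J \<gamma>" and st: "s \<in> J" "t \<in> J"
      and "parallel_transport A charge_connection J \<gamma> s t v w"
    then obtain V where V: "parallel_along A charge_connection J \<gamma> V" "V s = v" "V t = w"
      unfolding parallel_transport_def by blast
    have pts: "\<gamma> s \<in> points A" "\<gamma> t \<in> points A" using \<gamma> st by (auto simp: smooth_curve_def)
    have mem: "v \<in> tangent_space A (\<gamma> s)" "w \<in> tangent_space A (\<gamma> t)"
      using V st by (auto simp: parallel_along_def)
    have "K (\<gamma> s) = K (\<gamma> t)" using assms pts by (auto simp: constant_on_def)
    then have "finsleroid_energy a b K (\<gamma> t) w = finsleroid_energy a b K (\<gamma> s) v"
      using parallel_preserves[OF \<gamma> V(1) st] V(2,3)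
      by (simp add: finsleroid_energy_eq[OF pts(1) mem(1)] finsleroid_energy_eq[OF pts(2) mem(2)])
    then show "finsleroid_metric a b K (\<gamma> t) w = finsleroid_metric a b K (\<gamma> s) v"
      by (simp add: finsleroid_metric_def)
  qed
qed

end

theorem theorem9:
  fixes A :: "('m::{t2_space, second_countable_topology}, 'n::finite) chart set"
    and a :: "'m \<Rightarrow> ('m, 'n) tvector \<Rightarrow> ('m, 'n) tvector \<Rightarrow> real"
    and b :: "'m \<Rightarrow> ('m, 'n) tvector \<Rightarrow> real"
    and K :: "'m \<Rightarrow> real"
  assumes "smooth_atlas A" and "connected (points A)"
    and "riemannian_metric A a"
    and "one_form A b" and "unit_length A a b"
    and "smooth_function A K" and "K ` points A \<subseteq> {-4<..<4}"
  shows "(generalized_berwald A (finsleroid_metric a b K) \<longleftrightarrow>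
            finsleroid_charge K constant_on points A) \<and>
         (finsleroid_charge K constant_on points A \<longleftrightarrow> K constant_on points A)"
proof -
  interpret riemannian_form A a b by unfold_locales (fact assms)+
  have "finsleroid_charge K constant_on points A \<longleftrightarrow> K constant_on points A"
  proof
    assume "finsleroid_charge K constant_on points A"
    then obtain k where "\<forall>p\<in>points A. K p / 2 = k" by (auto simp: constant_on_def finsleroid_charge_def)
    then have "\<forall>p\<in>points A. K p = 2 * k" by auto
    then show "K constant_on points A" by (auto simp: constant_on_def)
  next
    assume "K constant_on points A"
    then obtain k where "\<forall>p\<in>points A. K p = k" by (auto simp: constant_on_def)
    then have "\<forall>p\<in>points A. finsleroid_charge K p = k / 2" by (simp add: finsleroid_charge_def)
    then show "finsleroid_charge K constant_on points A" unfolding constant_on_def by blast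
  qed
  moreover have "generalized_berwald A (finsleroid_metric a b K) \<longleftrightarrow> K constant_on points A"
    using generalized_berwald_imp_constant[of K] constant_imp_generalized_berwald[of K] assms by blast
  ultimately show ?thesis by blast
qed

end
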